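(* Let $\Gamma\subset\mathbb{R}^n$ and $\Gamma'\subset\mathbb{R}^{n'}$ each be the attractor of an iterated function system of contracting similarities satisfying the open set condition, and let $\mu$ and $\mu'$ be invariant measures on $\Gamma$ and $\Gamma'$ respectively. Let $h>0$, $\Gamma_{\mathrm{Hull},h}:=\bigcup_{\boldsymbol m\in L_h(\Gamma)}\mathrm{Hull}(\Gamma_{\boldsymbol m})$ and $\Gamma'_{\mathrm{Hull},h}:=\bigcup_{\boldsymbol m'\in L_h(\Gamma')}\mathrm{Hull}(\Gamma'_{\boldsymbol m'})$. Let $f:\Gamma_{\mathrm{Hull},h}\times\Gamma'_{\mathrm{Hull},h}\to\mathbb{C}$ be a function whose restriction to $\Gamma\times\Gamma'$ is continuous, and let $E:=|I_{\Gamma,\Gamma'}[f]-Q^h_{\Gamma,\Gamma'}[f]|$, where $I_{\Gamma,\Gamma'}[f]=\int_\Gamma\int_{\Gamma'}f(x,y)\,d\mu'(y)\,d\mu(x)$ and $Q^h_{\Gamma,\Gamma'}[f]=\sum_{\boldsymbol m\in L_h(\Gamma)}\sum_{\boldsymbol m'\in L_h(\Gamma')}\mu(\Gamma_{\boldsymbol m})\mu'(\Gamma'_{\boldsymbol m'})f(x_{\boldsymbol m},x'_{\boldsymbol m'})$. Then: (i) $E\le\sqrt2\,h\,\mu(\Gamma)\mu'(\Gamma')\max_{(\boldsymbol m,\boldsymbol m')\in L_h(\Gamma)\times L_h(\Gamma')}\mathcal{L}_{0,\mathrm{Hull}(\Gamma_{\boldsymbol m})\times\mathrm{Hull}(\Gamma'_{\boldsymbol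 m'})}[f]$. (ii) If $f$ is differentiable in an open set $\Omega\supset\Gamma_{\mathrm{Hull},h}\times\Gamma'_{\mathrm{Hull},h}$ then $$E\le\sqrt2\,h\,\mu(\Gamma)\mu'(\Gamma')\sup_{(x,x')\in\Gamma_{\mathrm{Hull},h}\times\Gamma'_{\mathrm{Hull},h}}|\nabla f(x,x')|\le\sqrt2\sqrt{n+n'}\,h\,\mu(\Gamma)\mu'(\Gamma')\sup_{(x,x')\in\Gamma_{\mathrm{Hull},h}\times\Gamma'_{\mathrm{Hull},h}}\max_{\alpha\in\mathbb{N}_0^{n+n'},|\alpha|=1}|D^\alpha f(x,x')|$$ and $$E\le2h^2\mu(\Gamma)\mu'(\Gamma')\max_{(\boldsymbol m,\boldsymbol m')\in L_h(\Gamma)\times L_h(\Gamma')}\mathcal{L}_{1,\mathrm{Hull}(\Gamma_{\boldsymbol m})\times\mathrm{Hull}(\Gamma'_{\boldsymbol m'})}[f].$$ (iii) If $f$ is twice differentiable in an open set $\Omega\supset\Gamma_{\mathrm{Hull},h}\times\Gamma'_{\mathrm{Hull},h}$ then $$E\le h^2\mu(\Gamma)\mu'(\Gamma')\sup_{(x,x')\in\Gamma_{\mathrm{Hull},h}\times\Gamma'_{\mathrm{Hull},h}}\|Hf(x,x')\|_2\le(n+n')h^2\mu(\Gamma)\mu'(\Gamma')\sup_{(x,x')\in\Gamma_{\mathrm{Hull},h}\times\Gamma'_{\mathrm{Hull},h}}\max_{\alpha\in\mathbb{N}_0^{n+n'},|\alpha|=2}|D^\alpha f(x,x')|.$$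
   Context: IFS: a collection $\{s_1,\dots,s_M\}$, $M\ge2$, of maps $s_m:\mathbb{R}^n\to\mathbb{R}^n$, $s_m(x)=\rho_mA_mx+\delta_m$, with $\rho_m\in(0,1)$, $A_m$ an orthogonal $n\times n$ matrix, $\delta_m\in\mathbb{R}^n$. Its attractor $\Gamma$ is the unique non-empty compact set with $\Gamma=\bigcup_{m=1}^Ms_m(\Gamma)$. Open set condition: there is a non-empty bounded open set $O\subset\mathbb{R}^n$ with $\bigcup_ms_m(O)\subset O$ and $s_m(O)\cap s_{m'}(O)=\emptyset$ for $m\ne m'$. The two attractors $\Gamma,\Gamma'$ come from possibly different IFSs (with possibly different numbers of maps and different Hausdorff dimensions). Invariant measure: given $p_m\in(0,1)$, $m=1,\dots,M$, with $\sum_mp_m=1$, an invariant measure $\mu$ on $\Gamma$ is a non-zero finite Borel regular measure supported on $\Gamma$ such that $\mu(A)=\sum_{m=1}^Mp_m\mu(s_m^{-1}(A))$ for every measurable $A\subset\mathbb{R}^n$. Vector indices: $I_\ell:=\{1,\dots,M\}^\ell$ for $\ell\in\mathbb{N}=\{1,2,\ldots\}$; for $\boldsymbol m=(m_1,\dots,m_\ell)\in I_\ell$, $s_{\boldsymbol m}:=s_{m_1}\circ\dots\circ s_{m_\ell}$ and $\Gamma_{\boldsymbol m}:=s_{\boldsymbol m}(\Gamma)$; also $\Gamma_0:=\Gamma$. For $0<h<\mathrm{diam}(\Gamma)$, $L_h(\Gamma)$ is the set of all $\boldsymbol m=(m_1,\dots,m_\ell)\in\bigcup_{\ell'\in\mathbb{N}}I_{\ell'}$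 with $\mathrm{diam}(\Gamma_{\boldsymbol m})\le h$ and $\mathrm{diam}(\Gamma_{(m_1,\dots,m_{\ell-1})})>h$ (with $\Gamma_{(m_1,\dots,m_{\ell-1})}$ replaced by $\Gamma$ if $\ell=1$); for $h\ge\mathrm{diam}(\Gamma)$, $L_h(\Gamma):=\{0\}$. The same definitions, with the IFS of $\Gamma'$, give $\Gamma'_{\boldsymbol m'}$ and $L_h(\Gamma')$. Barycentres: $x_{\boldsymbol m}:=\int_{\Gamma_{\boldsymbol m}}x\,d\mu(x)/\mu(\Gamma_{\boldsymbol m})$ and $x'_{\boldsymbol m'}:=\int_{\Gamma'_{\boldsymbol m'}}x\,d\mu'(x)/\mu'(\Gamma'_{\boldsymbol m'})$. $\mathrm{Hull}(E)$ is the convex hull of $E$. For a set $E$ (here $E\subset\mathbb{R}^{n+n'}$), $\mathcal{L}_{0,E}[f]:=\sup_{x\ne y\in E}\frac{|f(x)-f(y)|}{|x-y|}$ and $\mathcal{L}_{1,E}[f]:=\sup_{x\ne y\in E}\frac{|\nabla f(x)-\nabla f(y)|}{|x-y|}$ (values $+\infty$ allowed). $\nabla f$ and $Hf$ are the gradient and Hessian of $f$ as a function on (a subset of) $\mathbb{R}^{n+n'}$, $\|\cdot\|_2$ is the matrix norm induced by the Euclidean norm, and $D^\alpha$ is the partial derivative of multi-index $\alpha$. *)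

theory Defs
  imports "HOL-Analysis.Analysis"
begin

section \<open>Iterated function systems of contracting similarities\<close>

definition similarity_ifs :: "nat \<Rightarrow> (nat \<Rightarrow> real^'n \<Rightarrow> real^'n) \<Rightarrow> bool" where
  "similarity_ifs M s \<longleftrightarrow> M \<ge> 2 \<and>
     (\<forall>m\<in>{1..M}. \<exists>\<rho> A \<delta>. 0 < \<rho> \<and> \<rho> < 1 \<and> orthogonal_matrix A \<and>
        s m = (\<lambda>x. \<rho> *\<^sub>R (A *v x) + \<delta>))"

text \<open>The attractor is the unique set with this property; uniqueness is a theorem (Hutchinson),
  hence not part of the definition.\<close>

definition ifs_attractor :: "nat \<Rightarrow> (nat \<Rightarrow> real^'n \<Rightarrow> real^'n) \<Rightarrow> (real^'n) set \<Rightarrow> bool" where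
  "ifs_attractor M s \<Gamma> \<longleftrightarrow> \<Gamma> \<noteq> {} \<and> compact \<Gamma> \<and> \<Gamma> = (\<Union>m\<in>{1..M}. s m ` \<Gamma>)"

definition open_set_condition :: "nat \<Rightarrow> (nat \<Rightarrow> real^'n \<Rightarrow> real^'n) \<Rightarrow> bool" where
  "open_set_condition M s \<longleftrightarrow>
     (\<exists>U. U \<noteq> {} \<and> bounded U \<and> open U \<and> (\<Union>m\<in>{1..M}. s m ` U) \<subseteq> U \<and>
        (\<forall>m\<in>{1..M}. \<forall>m'\<in>{1..M}. m \<noteq> m' \<longrightarrow> s m ` U \<inter> s m' ` U = {}))"

text \<open>A finite measure on the Borel sets of Euclidean space is automatically regular, and the outer
  measure it induces is Borel regular by construction; regularity is therefore covered by
  the condition on \<open>sets \<mu>\<close>.\<close>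

definition invariant_measure ::
    "nat \<Rightarrow> (nat \<Rightarrow> real^'n \<Rightarrow> real^'n) \<Rightarrow> (nat \<Rightarrow> real) \<Rightarrow> (real^'n) set \<Rightarrow> (real^'n) measure \<Rightarrow> bool"
where
  "invariant_measure M s p \<Gamma> \<mu> \<longleftrightarrow>
     sets \<mu> = sets borel \<and> finite_measure \<mu> \<and> emeasure \<mu> UNIV \<noteq> 0 \<and> emeasure \<mu> (- \<Gamma>) = 0 \<and>
     (\<forall>A\<in>sets borel. measure \<mu> A = (\<Sum>m\<in>{1..M}. p m * measure \<mu> (s m -` A)))"

section \<open>Vector indices and the cubature rule\<close>

text \<open>A vector index is a list over \<open>{1..M}\<close>; the empty list plays the role of the extra index \<open>0\<close>,
  for which \<open>\<Gamma>\<^sub>0 = \<Gamma>\<close>.\<close>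

definition ifs_comp :: "(nat \<Rightarrow> real^'n \<Rightarrow> real^'n) \<Rightarrow> nat list \<Rightarrow> real^'n \<Rightarrow> real^'n" where
  "ifs_comp s w = foldr (\<lambda>m g. s m \<circ> g) w id"

definition ifs_piece :: "(nat \<Rightarrow> real^'n \<Rightarrow> real^'n) \<Rightarrow> (real^'n) set \<Rightarrow> nat list \<Rightarrow> (real^'n) set" where
  "ifs_piece s \<Gamma> w = ifs_comp s w ` \<Gamma>"

definition ifs_indices ::
    "nat \<Rightarrow> (nat \<Rightarrow> real^'n \<Rightarrow> real^'n) \<Rightarrow> (real^'n) set \<Rightarrow> real \<Rightarrow> nat list set" where
  "ifs_indices M s \<Gamma> h =
     (if h < diameter \<Gamma>
      then {w. w \<noteq> [] \<and> set w \<subseteq> {1..M} \<and> diameter (ifs_piece s \<Gamma> w) \<le> h \<and>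
              diameter (ifs_piece s \<Gamma> (butlast w)) > h}
      else {[]})"

definition barycentre :: "(real^'n) measure \<Rightarrow> (real^'n) set \<Rightarrow> real^'n" where
  "barycentre \<mu> S = (1 / measure \<mu> S) *\<^sub>R (LINT x:S|\<mu>. x)"

definition hull_union ::
    "nat \<Rightarrow> (nat \<Rightarrow> real^'n \<Rightarrow> real^'n) \<Rightarrow> (real^'n) set \<Rightarrow> real \<Rightarrow> (real^'n) set" where
  "hull_union M s \<Gamma> h = (\<Union>w\<in>ifs_indices M s \<Gamma> h. convex hull (ifs_piece s \<Gamma> w))"

definition double_integral ::
    "(real^'n) set \<Rightarrow> (real^'n) measure \<Rightarrow> (real^'k) set \<Rightarrow> (real^'k) measure \<Rightarrow>
     ((real^'n) \<times> (real^'k) \<Rightarrow> complex) \<Rightarrow> complex" where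
  "double_integral \<Gamma> \<mu> \<Gamma>' \<mu>' f = (LINT x:\<Gamma>|\<mu>. (LINT y:\<Gamma>'|\<mu>'. f (x, y)))"

definition cubature ::
    "nat \<Rightarrow> (nat \<Rightarrow> real^'n \<Rightarrow> real^'n) \<Rightarrow> (real^'n) set \<Rightarrow> (real^'n) measure \<Rightarrow>
     nat \<Rightarrow> (nat \<Rightarrow> real^'k \<Rightarrow> real^'k) \<Rightarrow> (real^'k) set \<Rightarrow> (real^'k) measure \<Rightarrow>
     real \<Rightarrow> ((real^'n) \<times> (real^'k) \<Rightarrow> complex) \<Rightarrow> complex" where
  "cubature M s \<Gamma> \<mu> M' s' \<Gamma>' \<mu>' h f =
     (\<Sum>w\<in>ifs_indices M s \<Gamma> h. \<Sum>w'\<in>ifs_indices M' s' \<Gamma>' h.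
        complex_of_real (measure \<mu> (ifs_piece s \<Gamma> w) * measure \<mu>' (ifs_piece s' \<Gamma>' w')) *
        f (barycentre \<mu> (ifs_piece s \<Gamma> w), barycentre \<mu>' (ifs_piece s' \<Gamma>' w')))"

section \<open>Derivatives of complex-valued functions on the product space\<close>

text \<open>The space of dimension \<open>n + n'\<close> is the product of the two factor spaces, which carries the
  Euclidean norm; its coordinates are indexed by the sum of the two index types.\<close>

definition coord_vec :: "'n::finite + 'k::finite \<Rightarrow> (real^'n) \<times> (real^'k)" where
  "coord_vec c = (case c of Inl i \<Rightarrow> (axis i 1, 0) | Inr j \<Rightarrow> (0, axis j 1))"

definition partial_deriv ::
    "'n::finite + 'k::finite \<Rightarrow> ((real^'n) \<times> (real^'k) \<Rightarrow> complex) \<Rightarrow>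
     (real^'n) \<times> (real^'k) \<Rightarrow> complex" where
  "partial_deriv c f z = vector_derivative (\<lambda>t. f (z + t *\<^sub>R coord_vec c)) (at 0)"

definition gradient ::
    "((real^'n::finite) \<times> (real^'k::finite) \<Rightarrow> complex) \<Rightarrow> (real^'n) \<times> (real^'k) \<Rightarrow> complex^('n + 'k)"
where
  "gradient f z = (\<chi> c. partial_deriv c f z)"

definition hessian ::
    "((real^'n::finite) \<times> (real^'k::finite) \<Rightarrow> complex) \<Rightarrow>
     (real^'n) \<times> (real^'k) \<Rightarrow> complex^('n + 'k)^('n + 'k)" where
  "hessian f z = (\<chi> c d. partial_deriv c (partial_deriv d f) z)"

definition twice_differentiable_on ::
    "((real^'n::finite) \<times> (real^'k::finite) \<Rightarrow> complex) \<Rightarrow> ((real^'n) \<times> (real^'k)) set \<Rightarrow> bool"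
where
  "twice_differentiable_on f S \<longleftrightarrow> f differentiable_on S \<and> gradient f differentiable_on S"

definition matrix_norm2 :: "complex^'c^'c \<Rightarrow> real" where
  "matrix_norm2 A = onorm (\<lambda>v. A *v v)"

text \<open>Multi-indices are functions from the coordinates to \<open>nat\<close>. The partial derivatives in
  \<open>multi_deriv\<close> are taken in the order of an arbitrary fixed enumeration of the coordinates; for
  orders up to two and twice (Frechet) differentiable functions the order is irrelevant.\<close>

definition multi_indices :: "nat \<Rightarrow> ('c::finite \<Rightarrow> nat) set" where
  "multi_indices r = {\<alpha>. (\<Sum>c\<in>UNIV. \<alpha> c) = r}"

definition coord_enum :: "'c::finite list" where
  "coord_enum = (SOME cs. distinct cs \<and> set cs = UNIV)"

definition multi_deriv ::
    "('n::finite + 'k::finite \<Rightarrow> nat) \<Rightarrow> ((real^'n) \<times> (real^'k) \<Rightarrow> complex) \<Rightarrow>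
     (real^'n) \<times> (real^'k) \<Rightarrow> complex" where
  "multi_deriv \<alpha> f = foldr (\<lambda>c. partial_deriv c ^^ \<alpha> c) coord_enum f"

text \<open>The suprema may be infinite, so they are taken in \<open>ennreal\<close> (where an empty one is \<open>0\<close>).
  The constants of orders 0 and 1 of \<open>f\<close> are those of \<open>f\<close> and of \<open>gradient f\<close>.\<close>

definition lip_const :: "'a::real_normed_vector set \<Rightarrow> ('a \<Rightarrow> 'b::real_normed_vector) \<Rightarrow> ennreal" where
  "lip_const S g = (SUP (x, y)\<in>{(x, y). x \<in> S \<and> y \<in> S \<and> x \<noteq> y}. ennreal (norm (g x - g y) / norm (x - y)))"

end

theory Submission
  imports Defs "HOL-Library.Sublist"
begin

text \<open>On a product \<open>\<Gamma>\<^sub>w \<times> \<Gamma>'\<^bsub>w'\<^esub>\<close> of two pieces the rule replaces \<open>f\<close> by its value at the pair \<open>b\<close> of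
  barycentres. The first moment of \<open>\<mu> \<otimes> \<mu>'\<close> about \<open>b\<close> vanishes, so the error there is at most the mass
  of the product times the sup of \<open>\<bar>f z - f b - T (z - b)\<bar>\<close>, for any real-linear \<open>T\<close>
  (\<open>one_point_cubature_error\<close>). Both \<open>z\<close> and \<open>b\<close> lie in a convex product of hulls and
  \<open>\<bar>z - b\<bar> \<le> \<surd>2 h\<close>. With \<open>T = 0\<close> the first-order bounds follow from the Lipschitz constant of \<open>f\<close> or
  the mean value inequality; with \<open>T\<close> the tangent at \<open>b\<close> the second-order ones follow from
  \<open>taylor_remainder_lipschitz_gradient\<close>, whose factor \<open>1/2\<close> cancels the \<open>2\<close> in \<open>\<bar>z - b\<bar>\<^sup>2 \<le> 2 h\<^sup>2\<close>.
  Passing between the Hessian and the derivative of the gradient, and between its entries and the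
  derivatives \<open>D\<^sup>\<alpha>\<close>, uses that second derivatives of a twice Frechet differentiable function are
  symmetric (\<open>second_derivative_symmetric\<close>).

  Summing over all pairs of pieces gives the total mass only if the pieces overlap in null sets
  (\<open>parallel_pieces_overlap_null\<close>), and this is where the open set condition enters. It bounds the
  number of pieces of comparable size that can touch a given piece. Take a word \<open>w\<close> for which this
  number is maximal. A prefix \<open>u\<close> maps the neighbours of \<open>\<Gamma>\<^sub>w\<close> to neighbours of \<open>\<Gamma>\<^bsub>uw\<^esub>\<close>, and by
  maximality there are no others: everything near \<open>\<Gamma>\<^bsub>uw\<^esub>\<close> lies inside \<open>\<Gamma>\<^sub>u\<close>. Hence, for all long
  enough \<open>u\<close>, the overlap \<open>A\<close> of two incomparable pieces misses \<open>\<Gamma>\<^bsub>uw\<^esub>\<close>, that is, the preimage of \<open>A\<close>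
  under \<open>s\<^bsub>uw\<^esub>\<close> misses \<open>\<Gamma>\<close>. If \<open>S\<close> is the supremum, over these \<open>u\<close>, of
  the measures of the preimages of \<open>A\<close> under \<open>s\<^sub>u\<close>, then self-similarity of \<open>\<mu>\<close> along \<open>w\<close> gives
  \<open>S \<le> (1 - p\<^sub>w) S\<close> with \<open>p\<^sub>w > 0\<close>. So \<open>S = 0\<close>, and \<open>A\<close> is null by self-similarity once more.\<close>

section \<open>Words and pieces of an iterated function system\<close>

lemma ifs_comp_Nil [simp]: "ifs_comp s [] = id"
  by (simp add: ifs_comp_def)

lemma ifs_comp_Cons [simp]: "ifs_comp s (m # w) = s m \<circ> ifs_comp s w"
  by (simp add: ifs_comp_def)

lemma ifs_comp_append: "ifs_comp s (u @ v) = ifs_comp s u \<circ> ifs_comp s v"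
  by (induction u) (auto simp: comp_assoc)

lemma ifs_piece_Nil [simp]: "ifs_piece s \<Gamma> [] = \<Gamma>"
  by (simp add: ifs_piece_def)

lemma ifs_piece_append: "ifs_piece s \<Gamma> (u @ v) = ifs_comp s u ` ifs_piece s \<Gamma> v"
  by (simp add: ifs_piece_def ifs_comp_append image_comp)

lemma diameter_similarity_image:
  fixes g :: "'a::metric_space \<Rightarrow> 'b::metric_space"
  assumes "compact S" "r \<ge> 0" and dist: "\<And>x y. dist (g x) (g y) = r * dist x y"
  shows "diameter (g ` S) = r * diameter S"
proof (cases "S = {}")
  case False
  have "r-lipschitz_on S g"
    using assms by (intro lipschitz_onI) auto
  then have cg: "compact (g ` S)"
    using assms(1) by (intro compact_continuous_image lipschitz_on_continuous_on)
  obtain x y where xy: "x \<in> S" "y \<in> S" "dist x y = diameter S"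
    using diameter_compact_attained[OF assms(1) False] by blast
  obtain x' y' where xy': "x' \<in> S" "y' \<in> S" "dist (g x') (g y') = diameter (g ` S)"
    using diameter_compact_attained[OF cg] False by blast
  have "diameter (g ` S) \<le> r * diameter S"
    unfolding xy'(3)[symmetric] dist
    using diameter_bounded_bound[OF compact_imp_bounded[OF assms(1)] xy'(1,2)] assms(2)
    by (intro mult_left_mono)
  moreover have "r * diameter S \<le> diameter (g ` S)"
    unfolding xy(3)[symmetric] dist[symmetric]
    using diameter_bounded_bound[OF compact_imp_bounded[OF cg]] xy by blast
  ultimately show ?thesis by simp
qed simp

text \<open>Of the matrix form of the maps, the arguments use the exact scaling of distances and surjectivity.\<close>

locale similarity_attractor =
  fixes M :: nat and s :: "nat \<Rightarrow> real^'n \<Rightarrow> real^'n" and \<rho> :: "nat \<Rightarrow> real"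
    and \<Gamma> :: "(real^'n) set"
  assumes ratio_pos: "m \<in> {1..M} \<Longrightarrow> 0 < \<rho> m"
    and ratio_less_1: "m \<in> {1..M} \<Longrightarrow> \<rho> m < 1"
    and dist_map: "m \<in> {1..M} \<Longrightarrow> dist (s m x) (s m y) = \<rho> m * dist x y"
    and surj_map: "m \<in> {1..M} \<Longrightarrow> surj (s m)"
    and attractor: "ifs_attractor M s \<Gamma>"
begin

abbreviation words :: "nat list set" where
  "words \<equiv> lists {1..M}"

abbreviation piece :: "nat list \<Rightarrow> (real^'n) set" where
  "piece w \<equiv> ifs_piece s \<Gamma> w"

definition ratio :: "nat list \<Rightarrow> real" where
  "ratio w = prod_list (map \<rho> w)"

lemma ratio_Nil [simp]: "ratio [] = 1"
  and ratio_Cons [simp]: "ratio (m # w) = \<rho> m * ratio w"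
  and ratio_append [simp]: "ratio (u @ v) = ratio u * ratio v"
  by (simp_all add: ratio_def)

lemma compact_attractor: "compact \<Gamma>"
  and attractor_nonempty: "\<Gamma> \<noteq> {}"
  and attractor_eq: "\<Gamma> = (\<Union>m\<in>{1..M}. s m ` \<Gamma>)"
  using attractor by (auto simp: ifs_attractor_def)

lemma ratio_word_pos: "w \<in> words \<Longrightarrow> 0 < ratio w"
  by (induction w) (use ratio_pos in auto)

lemma ratio_word_le_1: "w \<in> words \<Longrightarrow> ratio w \<le> 1"
proof (induction w)
  case (Cons m w)
  then show ?case
    using ratio_less_1[of m] ratio_pos[of m] ratio_word_pos[of w] mult_mono[of "\<rho> m" 1 "ratio w" 1]
    by auto
qed auto

lemma ratio_word_less_1: "w \<in> words \<Longrightarrow> w \<noteq> [] \<Longrightarrow> ratio w < 1"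
proof (cases w)
  case (Cons m v)
  assume "w \<in> words"
  then have "m \<in> {1..M}" "v \<in> words" using Cons by auto
  then have "\<rho> m * ratio v \<le> \<rho> m * 1"
    using ratio_word_le_1[of v] ratio_pos[of m] by (intro mult_left_mono) auto
  then show ?thesis using ratio_less_1[OF \<open>m \<in> _\<close>] Cons by simp
qed auto

lemma dist_comp: "w \<in> words \<Longrightarrow> dist (ifs_comp s w x) (ifs_comp s w y) = ratio w * dist x y"
  by (induction w) (use dist_map in auto)

lemma surj_comp: "w \<in> words \<Longrightarrow> surj (ifs_comp s w)"
proof (induction w)
  case (Cons m w)
  then show ?case using surj_map[of m] comp_surj[of "ifs_comp s w" "s m"] by simp
qed auto

lemma inj_comp: "w \<in> words \<Longrightarrow> inj (ifs_comp s w)"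
proof (rule injI)
  fix x y assume "w \<in> words" "ifs_comp s w x = ifs_comp s w y"
  then have "ratio w * dist x y = 0" using dist_comp[of w x y] by simp
  then show "x = y" using ratio_word_pos[OF \<open>w \<in> words\<close>] by simp
qed

lemma continuous_comp: "w \<in> words \<Longrightarrow> continuous_on S (ifs_comp s w)"
  by (intro lipschitz_on_continuous_on[of "ratio w"] lipschitz_onI)
     (simp_all add: dist_comp less_imp_le[OF ratio_word_pos])

lemma compact_piece: "w \<in> words \<Longrightarrow> compact (piece w)"
  unfolding ifs_piece_def by (intro compact_continuous_image continuous_comp compact_attractor)

lemma diameter_piece: "w \<in> words \<Longrightarrow> diameter (piece w) = ratio w * diameter \<Gamma>"
  unfolding ifs_piece_def
  by (intro diameter_similarity_image compact_attractor dist_comp less_imp_le[OF ratio_word_pos])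

lemma piece_subset_attractor: "w \<in> words \<Longrightarrow> piece w \<subseteq> \<Gamma>"
proof (induction w)
  case (Cons m w)
  then have "s m ` piece w \<subseteq> s m ` \<Gamma>" by auto
  also have "\<dots> \<subseteq> \<Gamma>" using Cons by (subst (2) attractor_eq) auto
  finally show ?case by (simp add: ifs_piece_def image_comp)
qed auto

lemma piece_prefix_mono:
  assumes "v \<in> words" "prefix u v"
  shows "piece v \<subseteq> piece u"
proof -
  obtain t where "v = u @ t" using assms by (auto elim: prefixE)
  then show ?thesis
    using assms piece_subset_attractor[of t] by (simp add: ifs_piece_append) (auto simp: ifs_piece_def)
qed

lemma piece_refine:
  assumes "x \<in> piece v"
  shows "\<exists>t\<in>words. length t = k \<and> x \<in> piece (v @ t)"
  using assms
proof (induction k arbitrary: v)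
  case (Suc k)
  have "piece v = (\<Union>m\<in>{1..M}. piece (v @ [m]))"
    unfolding ifs_piece_append by (subst ifs_piece_def, subst attractor_eq) (auto simp: ifs_piece_def)
  then obtain m where m: "m \<in> {1..M}" "x \<in> piece (v @ [m])" using Suc.prems by auto
  from Suc.IH[OF m(2)] obtain t where "t \<in> words" "length t = k" "x \<in> piece (v @ [m] @ t)"
    by auto
  then show ?case using m by (intro bexI[of _ "m # t"]) auto
qed auto

lemma index_set_nonempty: "1 \<in> {1..M}"
  using attractor_eq attractor_nonempty by (cases "M = 0") auto

definition max_ratio :: real where
  "max_ratio = Max (\<rho> ` {1..M})"

definition min_ratio :: real where
  "min_ratio = Min (\<rho> ` {1..M})"

lemma max_ratio_less_1: "max_ratio < 1"
  unfolding max_ratio_def using index_set_nonempty ratio_less_1 by (subst Max_less_iff) auto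

lemma max_ratio_pos: "0 < max_ratio"
  unfolding max_ratio_def using index_set_nonempty ratio_pos by (subst Max_gr_iff) auto

lemma min_ratio_pos: "0 < min_ratio"
  unfolding min_ratio_def using index_set_nonempty ratio_pos by (subst Min_gr_iff) auto

lemma ratio_word_le_power: "w \<in> words \<Longrightarrow> ratio w \<le> max_ratio ^ length w"
proof (induction w)
  case (Cons m w)
  then have "\<rho> m \<le> max_ratio" by (simp add: max_ratio_def)
  with Cons show ?case
    using ratio_word_pos[of w] max_ratio_pos by (auto intro!: mult_mono)
qed auto

text \<open>The words at which the contraction ratio first drops to the scale \<open>b\<close>; they form a finite
  antichain for the prefix order whose pieces all have size comparable to \<open>b\<close>. For
  \<open>0 < h < diam \<Gamma>\<close> the index set \<open>L\<^sub>h\<close> is \<open>stopping (h / diam \<Gamma>)\<close>.\<close>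

definition stopping :: "real \<Rightarrow> nat list set" where
  "stopping b = {w \<in> words. w \<noteq> [] \<and> ratio w \<le> b \<and> b < ratio (butlast w)}"

lemma stopping_words: "w \<in> stopping b \<Longrightarrow> w \<in> words"
  by (simp add: stopping_def)

lemma finite_stopping:
  assumes "0 < b"
  shows "finite (stopping b)"
proof -
  obtain N where N: "max_ratio ^ N < b"
    using real_arch_pow_inv[OF assms max_ratio_less_1] by blast
  have "length w \<le> Suc N" if w: "w \<in> stopping b" for w
  proof (rule ccontr)
    assume "\<not> length w \<le> Suc N"
    then have "N \<le> length (butlast w)" by simp
    then have "max_ratio ^ length (butlast w) \<le> max_ratio ^ N"
      using max_ratio_pos max_ratio_less_1 by (intro power_decreasing) auto
    moreover have "butlast w \<in> words" using w by (auto simp: stopping_def dest: in_set_butlastD)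
    ultimately have "ratio (butlast w) < b" using ratio_word_le_power N by fastforce
    then show False using w by (simp add: stopping_def)
  qed
  then have "stopping b \<subseteq> {w. set w \<subseteq> {1..M} \<and> length w \<le> Suc N}"
    by (auto simp: stopping_def)
  then show ?thesis
    by (rule finite_subset) (rule finite_lists_length_le, simp)
qed

lemma stopping_prefix_exists:
  assumes "u \<in> words" "ratio u \<le> b" "b < 1"
  shows "\<exists>v\<in>stopping b. prefix v u"
  using assms
proof (induction u rule: rev_induct)
  case (snoc m u)
  show ?case
  proof (cases "ratio u \<le> b")
    case True
    then show ?thesis using snoc by (auto intro: prefix_order.trans)
  next
    case False
    then have "u @ [m] \<in> stopping b" using snoc.prems by (auto simp: stopping_def)
    then show ?thesis by blast
  qed
qed auto

lemma stopping_antichain: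
  assumes "v \<in> stopping b" "v' \<in> stopping b" "prefix v v'"
  shows "v = v'"
proof (rule ccontr)
  assume "v \<noteq> v'"
  with assms(3) obtain t where t: "v' = v @ t" "t \<noteq> []" by (auto elim: prefixE)
  have *: "butlast t \<in> words" "v \<in> words"
    using assms(1,2) t by (auto simp: stopping_def dest: in_set_butlastD)
  have "ratio (butlast v') = ratio v * ratio (butlast t)"
    using t by (simp add: butlast_append)
  also have "\<dots> \<le> ratio v * 1"
    using * ratio_word_le_1 ratio_word_pos[of v] by (intro mult_left_mono) auto
  finally show False using assms(1,2) by (simp add: stopping_def)
qed

lemma stopping_parallel:
  assumes "v \<in> stopping b" "v' \<in> stopping b" "v \<noteq> v'"
  shows "v \<parallel> v'"
  using stopping_antichain[OF assms(1,2)] stopping_antichain[OF assms(2,1)] assms(3)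
  by (auto simp: parallel_def)

lemma stopping_cover:
  assumes "v \<in> words" "x \<in> piece v" "0 < b" "b < 1"
  shows "\<exists>v'\<in>stopping b. x \<in> piece v' \<and> (prefix v v' \<or> prefix v' v)"
proof -
  obtain N where N: "max_ratio ^ N < b"
    using real_arch_pow_inv[OF assms(3) max_ratio_less_1] by blast
  obtain t where t: "t \<in> words" "length t = N" "x \<in> piece (v @ t)"
    using piece_refine[OF assms(2)] by blast
  have vt: "v @ t \<in> words" using assms(1) t(1) by simp
  have "ratio (v @ t) \<le> 1 * ratio t"
    using ratio_word_le_1[OF assms(1)] ratio_word_pos[OF t(1)] by (simp add: mult_right_mono)
  also have "\<dots> \<le> b" using ratio_word_le_power[OF t(1)] N t(2) by simp
  finally obtain v' where v': "v' \<in> stopping b" "prefix v' (v @ t)"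
    using stopping_prefix_exists[OF vt _ assms(4)] by blast
  have "x \<in> piece v'" using piece_prefix_mono[OF vt v'(2)] t(3) by blast
  then show ?thesis
    using v' prefix_same_cases[of v' "v @ t" v] by (auto intro!: bexI[of _ v'])
qed

lemma stopping_append:
  assumes "u \<in> words" "v \<in> stopping b"
  shows "u @ v \<in> stopping (ratio u * b)"
  using assms ratio_word_pos[OF assms(1)] by (auto simp: stopping_def butlast_append)

lemma stopping_ratio_ge:
  assumes "v \<in> stopping b" "0 < b"
  shows "min_ratio * b \<le> ratio v"
proof -
  obtain u m where um: "v = u @ [m]" using assms(1) by (cases v rule: rev_cases) (auto simp: stopping_def)
  then have "m \<in> {1..M}" "b < ratio u" using assms(1) by (auto simp: stopping_def)
  moreover from \<open>m \<in> _\<close> have "min_ratio \<le> \<rho> m" by (simp add: min_ratio_def)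
  ultimately have "min_ratio * b \<le> \<rho> m * ratio u"
    using assms(2) min_ratio_pos by (intro mult_mono) auto
  then show ?thesis by (simp add: um mult.commute)
qed

definition neighbours :: "nat list \<Rightarrow> nat list set" where
  "neighbours w = {v \<in> stopping (ratio w). piece v \<inter> piece w \<noteq> {}}"

lemma append_neighbours:
  assumes "u \<in> words" "w \<in> words"
  shows "(@) u ` neighbours w \<subseteq> neighbours (u @ w)"
proof safe
  fix v assume v: "v \<in> neighbours w"
  then obtain x where x: "x \<in> piece v" "x \<in> piece w" by (auto simp: neighbours_def)
  then have "ifs_comp s u x \<in> piece (u @ v) \<inter> piece (u @ w)"
    unfolding ifs_piece_append by blast
  then show "u @ v \<in> neighbours (u @ w)"
    using v stopping_append[OF assms(1), of v "ratio w"] by (auto simp: neighbours_def)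
qed

end

section \<open>The open set condition bounds the number of neighbours\<close>

locale osc_attractor = similarity_attractor M s \<rho> \<Gamma>
  for M :: nat and s :: "nat \<Rightarrow> real^'n \<Rightarrow> real^'n" and \<rho> :: "nat \<Rightarrow> real" and \<Gamma> :: "(real^'n) set" +
  assumes osc: "open_set_condition M s"
begin

text \<open>Take a ball in the open set \<open>U\<close> of the condition: its copies under incomparable words lie in
  disjoint copies of \<open>U\<close>, so their centres are apart by at least a radius.\<close>

lemma parallel_copies_separated:
  "\<exists>a \<epsilon>. 0 < \<epsilon> \<and> (\<forall>u\<in>words. \<forall>v\<in>words. u \<parallel> v \<longrightarrow>
     \<epsilon> * ratio u \<le> dist (ifs_comp s u a) (ifs_comp s v a))"
proof -
  obtain U where "U \<noteq> {} \<and> bounded U \<and> open U \<and> (\<Union>m\<in>{1..M}. s m ` U) \<subseteq> U \<and>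
        (\<forall>m\<in>{1..M}. \<forall>m'\<in>{1..M}. m \<noteq> m' \<longrightarrow> s m ` U \<inter> s m' ` U = {})"
    using osc unfolding open_set_condition_def ..
  then have U: "U \<noteq> {}" "open U" "\<And>m. m \<in> {1..M} \<Longrightarrow> s m ` U \<subseteq> U"
    and disj: "\<And>m m'. m \<in> {1..M} \<Longrightarrow> m' \<in> {1..M} \<Longrightarrow> m \<noteq> m' \<Longrightarrow> s m ` U \<inter> s m' ` U = {}"
    by blast+
  obtain a \<epsilon> where a: "a \<in> U" "0 < \<epsilon>" "ball a \<epsilon> \<subseteq> U"
    using U(1,2) by (meson ex_in_conv openE)
  have comp_U: "ifs_comp s w ` U \<subseteq> U" if "w \<in> words" for w
    using that
  proof (induction w)
    case (Cons m w)
    then have "s m ` ifs_comp s w ` U \<subseteq> s m ` U" by auto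
    also have "\<dots> \<subseteq> U" using U(3)[of m] Cons by auto
    finally show ?case by (simp add: image_comp)
  qed auto
  have disj_comp: "ifs_comp s u ` U \<inter> ifs_comp s v ` U = {}"
    if uv: "u \<in> words" "v \<in> words" "u \<parallel> v" for u v
  proof -
    obtain t m u' m' v' where d: "m \<noteq> m'" "u = t @ m # u'" "v = t @ m' # v'"
      using parallel_decomp[OF uv(3)] by blast
    have "s m ` ifs_comp s u' ` U \<inter> s m' ` ifs_comp s v' ` U \<subseteq> s m ` U \<inter> s m' ` U"
      using comp_U[of u'] comp_U[of v'] uv d by (intro Int_mono image_mono) auto
    also have "\<dots> = {}" using disj[of m m'] d uv by auto
    finally have "ifs_comp s t ` (s m ` ifs_comp s u' ` U \<inter> s m' ` ifs_comp s v' ` U) = {}"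
      by blast
    moreover have "ifs_comp s u ` U = ifs_comp s t ` s m ` ifs_comp s u' ` U"
        "ifs_comp s v ` U = ifs_comp s t ` s m' ` ifs_comp s v' ` U"
      by (simp_all add: d ifs_comp_append image_comp comp_assoc)
    moreover have "t \<in> words" using uv(1) d by simp
    ultimately show ?thesis by (simp only: image_Int[OF inj_comp])
  qed
  have "\<epsilon> * ratio u \<le> dist (ifs_comp s u a) (ifs_comp s v a)"
    if uv: "u \<in> words" "v \<in> words" "u \<parallel> v" for u v
  proof (rule ccontr)
    assume *: "\<not> ?thesis"
    obtain x where x: "ifs_comp s v a = ifs_comp s u x"
      using surj_comp[OF uv(1)] by (metis surjD)
    then have "ratio u * dist a x < \<epsilon> * ratio u" using * dist_comp[OF uv(1)] by simp
    then have "dist a x < \<epsilon>" using ratio_word_pos[OF uv(1)] by simp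
    then have "x \<in> U" using a(3) by auto
    then show False using disj_comp[OF uv] x a(1) by auto
  qed
  then show ?thesis using a(2) by blast
qed

text \<open>By the previous lemma, the neighbours of \<open>w\<close> give points that are separated at the scale
  \<open>ratio w\<close> and lie, at the same scale, in a bounded region; after rescaling, a fixed finite
  \<open>\<delta>/2\<close>-net of a fixed ball can tell them all apart.\<close>

lemma neighbours_bounded: "\<exists>N. \<forall>w\<in>words. finite (neighbours w) \<and> card (neighbours w) \<le> N"
proof -
  obtain a \<epsilon> where \<epsilon>: "0 < \<epsilon>" and sep: "\<And>u v. u \<in> words \<Longrightarrow> v \<in> words \<Longrightarrow> u \<parallel> v \<Longrightarrow>
     \<epsilon> * ratio u \<le> dist (ifs_comp s u a) (ifs_comp s v a)"
    using parallel_copies_separated by blast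
  obtain R where R: "\<And>x. x \<in> \<Gamma> \<Longrightarrow> dist a x \<le> R"
    using compact_imp_bounded[OF compact_attractor] by (meson bounded_any_center)
  define \<delta> where "\<delta> = \<epsilon> * min_ratio"
  have \<delta>: "0 < \<delta>" using \<epsilon> min_ratio_pos by (simp add: \<delta>_def)
  (* rescaled copies of a point lie within R + 2 R of a point of the piece they touch *)
  obtain Net where Net: "finite Net" "cball (0::real^'n) (3 * R) \<subseteq> (\<Union>x\<in>Net. ball x (\<delta> / 2))"
    using compact_cball[of 0 "3 * R"] \<delta> unfolding compact_eq_totally_bounded
    by (metis half_gt_zero)
  have "finite (neighbours w) \<and> card (neighbours w) \<le> card Net" if w: "w \<in> words" for w
  proof -
    have r: "0 < ratio w" using ratio_word_pos[OF w] .
    obtain x0 where x0: "x0 \<in> \<Gamma>" using attractor_nonempty by blast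
    define q where "q v = (1 / ratio w) *\<^sub>R (ifs_comp s v a - ifs_comp s w x0)" for v
    have q_bound: "q v \<in> cball 0 (3 * R)" if v: "v \<in> neighbours w" for v
    proof -
      have vw: "v \<in> words" "ratio v \<le> ratio w"
        using v by (auto simp: neighbours_def stopping_def)
      obtain y y' where y: "y \<in> \<Gamma>" "y' \<in> \<Gamma>" "ifs_comp s v y = ifs_comp s w y'"
        using v by (auto simp: neighbours_def ifs_piece_def)
      have "dist (ifs_comp s v a) (ifs_comp s w x0)
          \<le> dist (ifs_comp s v a) (ifs_comp s v y) + dist (ifs_comp s w y') (ifs_comp s w x0)"
        using y(3) by (metis dist_triangle)
      also have "\<dots> = ratio v * dist a y + ratio w * dist y' x0"
        using dist_comp vw(1) w by simp
      also have "\<dots> \<le> ratio w * R + ratio w * (2 * R)"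
        using R[OF y(1)] R[OF y(2)] R[OF x0] vw ratio_word_pos[OF vw(1)] dist_triangle2[of y' x0 a]
        by (intro add_mono mult_mono) (auto simp: dist_commute intro: order_trans[OF zero_le_dist])
      finally have "dist (ifs_comp s v a) (ifs_comp s w x0) \<le> ratio w * (3 * R)"
        by (simp add: algebra_simps)
      then have "norm (q v) \<le> 3 * R"
        using r unfolding q_def norm_scaleR dist_norm by (simp add: field_simps)
      then show ?thesis by simp
    qed
    have q_sep: "\<delta> \<le> dist (q v) (q v')"
      if v: "v \<in> neighbours w" "v' \<in> neighbours w" "v \<noteq> v'" for v v'
    proof -
      have st: "v \<in> stopping (ratio w)" "v' \<in> stopping (ratio w)"
        using v by (auto simp: neighbours_def)
      have "\<delta> * ratio w = \<epsilon> * (min_ratio * ratio w)" by (simp add: \<delta>_def)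
      also have "\<dots> \<le> \<epsilon> * ratio v"
        using stopping_ratio_ge[OF st(1) r] \<epsilon> by (intro mult_left_mono) auto
      also have "\<dots> \<le> dist (ifs_comp s v a) (ifs_comp s v' a)"
        using sep stopping_parallel[OF st v(3)] st stopping_words by blast
      also have "\<dots> = ratio w * dist (q v) (q v')"
      proof -
        have "q v - q v' = (1 / ratio w) *\<^sub>R (ifs_comp s v a - ifs_comp s v' a)"
          by (simp add: q_def algebra_simps)
        then show ?thesis using r by (simp add: dist_norm)
      qed
      finally show ?thesis using r by simp
    qed
    have "\<forall>v\<in>neighbours w. \<exists>z\<in>Net. q v \<in> ball z (\<delta> / 2)"
      using q_bound Net(2) by blast
    then obtain z where z: "\<And>v. v \<in> neighbours w \<Longrightarrow> z v \<in> Net \<and> dist (z v) (q v) < \<delta> / 2"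
      by (metis mem_ball)
    have "inj_on z (neighbours w)"
    proof (rule inj_onI, rule ccontr)
      fix v v' assume v: "v \<in> neighbours w" "v' \<in> neighbours w" "z v = z v'" "v \<noteq> v'"
      have "dist (q v) (q v') \<le> dist (z v) (q v) + dist (z v) (q v')" by (rule dist_triangle3)
      also have "\<dots> < \<delta>" using z[OF v(1)] z[OF v(2)] v(3) by simp
      finally show False using q_sep[OF v(1,2,4)] by simp
    qed
    moreover have "z ` neighbours w \<subseteq> Net" using z by blast
    ultimately show ?thesis
      using Net(1) by (auto intro: inj_on_finite card_inj_on_le)
  qed
  then show ?thesis by blast
qed

text \<open>Choose a non-empty word \<open>w\<close> with the largest possible number of neighbours. Prefixing by \<open>u\<close>
  carries the neighbours of \<open>w\<close> injectively into those of \<open>u @ w\<close>, so by maximality these are all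
  of them: near \<open>\<Gamma>\<^bsub>u @ w\<^esub>\<close> there are no pieces of its size but those inside \<open>\<Gamma>\<^sub>u\<close>.\<close>

lemma isolating_word_exists:
  "\<exists>w\<in>words. w \<noteq> [] \<and> (\<forall>u\<in>words. \<forall>v\<in>neighbours (u @ w). prefix u v)"
proof -
  obtain N where N: "\<And>w. w \<in> words \<Longrightarrow> finite (neighbours w) \<and> card (neighbours w) \<le> N"
    using neighbours_bounded by blast
  let ?P = "\<lambda>w. w \<in> words \<and> w \<noteq> []"
  have "?P [1]" using index_set_nonempty by simp
  then obtain w where w: "?P w" and max: "\<And>v. ?P v \<Longrightarrow> card (neighbours v) \<le> card (neighbours w)"
    using ex_has_greatest_nat[of ?P "[1]" "\<lambda>w. card (neighbours w)" "Suc N"] N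
    by (metis le_imp_less_Suc)
  have "prefix u v" if u: "u \<in> words" and v: "v \<in> neighbours (u @ w)" for u v
  proof -
    have uw: "?P (u @ w)" using u w by simp
    have "card ((@) u ` neighbours w) = card (neighbours w)"
      by (intro card_image) (simp add: inj_on_def)
    then have "(@) u ` neighbours w = neighbours (u @ w)"
      using append_neighbours[OF u] w N[of "u @ w"] uw max[OF uw] by (intro card_seteq) auto
    then show ?thesis using v by (metis imageE prefixI)
  qed
  then show ?thesis using w by blast
qed

text \<open>A point of \<open>\<Gamma>\<^bsub>u @ w\<^esub>\<close> that also lies in \<open>\<Gamma>\<^sub>v\<close> lies in a piece of the size of \<open>\<Gamma>\<^bsub>u @ w\<^esub>\<close> whose
  word is comparable to \<open>v\<close>, and which is then a neighbour inside \<open>\<Gamma>\<^sub>u\<close>.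
  As \<open>u\<close> is at least as long as \<open>v\<close>, this makes \<open>v\<close> a prefix of \<open>u\<close>, which cannot happen for two
  incomparable words.\<close>

lemma isolating_word_avoids_overlap:
  "\<exists>w\<in>words. \<forall>v\<in>words. \<forall>v'\<in>words. v \<parallel> v' \<longrightarrow>
     (\<forall>u\<in>words. max (length v) (length v') \<le> length u \<longrightarrow> piece (u @ w) \<inter> (piece v \<inter> piece v') = {})"
proof -
  obtain w where w: "w \<in> words" "w \<noteq> []"
    and iso: "\<And>u v. u \<in> words \<Longrightarrow> v \<in> neighbours (u @ w) \<Longrightarrow> prefix u v"
    using isolating_word_exists by blast
  have pre: "prefix v u"
    if v: "v \<in> words" and u: "u \<in> words" and len: "length v \<le> length u"
      and x: "x \<in> piece (u @ w)" "x \<in> piece v" for u v x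
  proof -
    have uw: "u @ w \<in> words" using w u by simp
    obtain v'' where v'': "v'' \<in> stopping (ratio (u @ w))" "x \<in> piece v''"
        "prefix v v'' \<or> prefix v'' v"
      using stopping_cover[OF v x(2) ratio_word_pos[OF uw] ratio_word_less_1[OF uw]] w(2) by auto
    have "v'' \<in> neighbours (u @ w)" using v'' x by (auto simp: neighbours_def)
    then have uv'': "prefix u v''" using iso u by blast
    show ?thesis
    proof (cases "prefix v v''")
      case True
      then show ?thesis using uv'' len prefix_length_prefix by blast
    next
      case False
      then have "prefix u v" using v''(3) uv'' by (auto intro: prefix_order.trans)
      then show ?thesis
        using len prefix_length_prefix[of v v u] by simp
    qed
  qed
  have "piece (u @ w) \<inter> (piece v \<inter> piece v') = {}"
    if "v \<in> words" "v' \<in> words" "v \<parallel> v'" "u \<in> words" "max (length v) (length v') \<le> length u" for u v v'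
  proof (rule ccontr)
    assume "\<not> ?thesis"
    then obtain x where "x \<in> piece (u @ w)" "x \<in> piece v" "x \<in> piece v'" by blast
    then have "prefix v u" "prefix v' u" using pre that by auto
    then show False using that(3) prefix_same_cases by blast
  qed
  then show ?thesis using w by blast
qed

end

section \<open>Pieces overlap in null sets\<close>

locale invariant_measure_attractor = osc_attractor M s \<rho> \<Gamma>
  for M :: nat and s :: "nat \<Rightarrow> real^'n \<Rightarrow> real^'n" and \<rho> :: "nat \<Rightarrow> real" and \<Gamma> :: "(real^'n) set" +
  fixes p :: "nat \<Rightarrow> real" and \<mu> :: "(real^'n) measure"
  assumes weight_pos: "m \<in> {1..M} \<Longrightarrow> 0 < p m"
    and weight_sum: "(\<Sum>m\<in>{1..M}. p m) = 1"
    and invariant: "invariant_measure M s p \<Gamma> \<mu>"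
begin

lemma sets_eq [measurable_cong]: "sets \<mu> = sets borel"
  and finite_measure: "finite_measure \<mu>"
  and emeasure_nonzero: "emeasure \<mu> UNIV \<noteq> 0"
  and emeasure_off_attractor: "emeasure \<mu> (- \<Gamma>) = 0"
  and self_similar: "A \<in> sets borel \<Longrightarrow> measure \<mu> A = (\<Sum>m\<in>{1..M}. p m * measure \<mu> (s m -` A))"
  using invariant by (auto simp: invariant_measure_def)

sublocale finite_measure \<mu> by (rule finite_measure)

lemma space_eq [simp]: "space \<mu> = UNIV"
  using sets_eq_imp_space_eq[OF sets_eq] by simp

lemma vimage_comp_borel:
  assumes "w \<in> words" "A \<in> sets borel"
  shows "ifs_comp s w -` A \<in> sets borel"
  using measurable_sets[OF borel_measurable_continuous_onI[OF continuous_comp[OF assms(1)]] assms(2)]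
  by simp

lemma attractor_borel [measurable]: "\<Gamma> \<in> sets borel"
  using compact_attractor by (simp add: borel_compact)

lemma piece_borel: "w \<in> words \<Longrightarrow> piece w \<in> sets borel"
  using compact_piece by (simp add: borel_compact)

lemma measure_disjoint_attractor:
  assumes "A \<inter> \<Gamma> = {}"
  shows "measure \<mu> A = 0"
proof -
  have "measure \<mu> A \<le> measure \<mu> (- \<Gamma>)"
    using assms by (intro finite_measure_mono) (auto simp: sets_eq)
  also have "\<dots> = 0" using emeasure_off_attractor by (simp add: measure_def)
  finally show ?thesis using measure_nonneg[of \<mu> A] by linarith
qed

lemma measure_attractor_pos: "0 < measure \<mu> \<Gamma>"
proof -
  have "emeasure \<mu> UNIV = emeasure \<mu> (\<Gamma> \<union> - \<Gamma>)" by simp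
  also have "\<dots> \<le> emeasure \<mu> \<Gamma> + emeasure \<mu> (- \<Gamma>)"
    by (rule emeasure_subadditive) (auto simp: sets_eq)
  finally have "emeasure \<mu> \<Gamma> \<noteq> 0" using emeasure_nonzero emeasure_off_attractor by auto
  then show ?thesis by (simp add: emeasure_eq_measure zero_less_measure_iff)
qed

definition weight :: "nat list \<Rightarrow> real" where
  "weight w = prod_list (map p w)"

lemma weight_Nil [simp]: "weight [] = 1" and weight_Cons [simp]: "weight (m # w) = p m * weight w"
  by (simp_all add: weight_def)

lemma weight_word_pos: "w \<in> words \<Longrightarrow> 0 < weight w"
  by (induction w) (use weight_pos in auto)

lemma weight_measure_vimage_le:
  assumes "w \<in> words" and "A \<in> sets borel"
  shows "weight w * measure \<mu> (ifs_comp s w -` A) \<le> measure \<mu> A"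
  using assms
proof (induction w arbitrary: A)
  case (Cons m w A)
  then have m: "m \<in> {1..M}" "w \<in> words" by auto
  have A': "s m -` A \<in> sets borel" using vimage_comp_borel[of "[m]" A] m Cons.prems by simp
  have "weight (m # w) * measure \<mu> (ifs_comp s (m # w) -` A)
      = p m * (weight w * measure \<mu> (ifs_comp s w -` (s m -` A)))"
    by (simp add: vimage_comp)
  also have "\<dots> \<le> p m * measure \<mu> (s m -` A)"
    using Cons.IH[OF A'] weight_pos[OF m(1)] by (intro mult_left_mono) auto
  also have "\<dots> \<le> (\<Sum>m\<in>{1..M}. p m * measure \<mu> (s m -` A))"
    using m weight_pos
    by (intro member_le_sum[of m "{1..M}" "\<lambda>m. p m * measure \<mu> (s m -` A)"]) (simp_all add: less_imp_le)
  also have "\<dots> = measure \<mu> A" using self_similar Cons.prems by simp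
  finally show ?case .
qed auto

lemma measure_piece_pos:
  assumes "w \<in> words"
  shows "0 < measure \<mu> (piece w)"
proof -
  have "\<Gamma> \<subseteq> ifs_comp s w -` piece w" by (auto simp: ifs_piece_def)
  then have "measure \<mu> \<Gamma> \<le> measure \<mu> (ifs_comp s w -` piece w)"
    using vimage_comp_borel[OF assms piece_borel[OF assms]]
    by (intro finite_measure_mono) (auto simp: sets_eq)
  then have "0 < weight w * measure \<mu> (ifs_comp s w -` piece w)"
    using measure_attractor_pos weight_word_pos[OF assms] by simp
  also have "\<dots> \<le> measure \<mu> (piece w)"
    using weight_measure_vimage_le[OF assms piece_borel[OF assms]] .
  finally show ?thesis .
qed

text \<open>If \<open>S\<close> bounds the measure of all preimages of \<open>A\<close>, unfolding self-similarity along the letters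
  of \<open>w\<close> and using the bound \<open>S\<close> off that path bounds \<open>A\<close> by a convex combination.\<close>

lemma measure_le_along_word:
  assumes "w \<in> words" "A \<in> sets borel"
    and S: "\<And>u. u \<in> words \<Longrightarrow> measure \<mu> (ifs_comp s u -` A) \<le> S"
  shows "measure \<mu> A \<le> (1 - weight w) * S + weight w * measure \<mu> (ifs_comp s w -` A)"
  using assms
proof (induction w arbitrary: A)
  case (Cons m w)
  then have m: "m \<in> {1..M}" "w \<in> words" by auto
  have A': "s m -` A \<in> sets borel" using vimage_comp_borel[of "[m]" A] m Cons.prems by simp
  have S': "measure \<mu> (ifs_comp s u -` (s m -` A)) \<le> S" if "u \<in> words" for u
    using Cons.prems(2)[of "m # u"] m that by (simp add: vimage_comp comp_def)
  have "measure \<mu> A = p m * measure \<mu> (s m -` A) + (\<Sum>k\<in>{1..M} - {m}. p k * measure \<mu> (s k -` A))"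
    using self_similar[OF Cons.prems(1)] m by (simp add: sum.remove)
  also have "\<dots> \<le> p m * measure \<mu> (s m -` A) + (\<Sum>k\<in>{1..M} - {m}. p k * S)"
  proof (intro add_left_mono sum_mono mult_left_mono)
    fix k assume k: "k \<in> {1..M} - {m}"
    show "measure \<mu> (s k -` A) \<le> S" using Cons.prems(2)[of "[k]"] k by simp
    show "0 \<le> p k" using weight_pos[of k] k by simp
  qed
  also have "(\<Sum>k\<in>{1..M} - {m}. p k * S) = (1 - p m) * S"
    using weight_sum m by (simp add: sum_distrib_right[symmetric] sum_diff1)
  also have "p m * measure \<mu> (s m -` A)
      \<le> p m * ((1 - weight w) * S + weight w * measure \<mu> (ifs_comp s w -` (s m -` A)))"
    using Cons.IH[OF A' S'] weight_pos[OF m(1)] by (intro mult_left_mono) auto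
  finally show ?case by (simp add: vimage_comp comp_def algebra_simps)
qed auto

text \<open>The supremum \<open>S\<close> of the measures of all preimages \<open>s\<^sub>u\<^sup>-\<^sup>1(A)\<close> satisfies
  \<open>S \<le> (1 - weight w) S\<close>, hence vanishes, as soon as each of them misses \<open>\<Gamma>\<^sub>w\<close>.\<close>

lemma null_if_preimages_miss_piece:
  assumes w: "w \<in> words" and A: "A \<in> sets borel"
    and miss: "\<And>u. u \<in> words \<Longrightarrow> piece (u @ w) \<inter> A = {}"
  shows "measure \<mu> A = 0"
proof -
  define S where "S = (SUP u\<in>words. measure \<mu> (ifs_comp s u -` A))"
  have bdd: "bdd_above ((\<lambda>u. measure \<mu> (ifs_comp s u -` A)) ` words)"
    by (intro bdd_aboveI[of _ "measure \<mu> UNIV"])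
       (auto intro!: finite_measure_mono simp: sets_eq)
  have upper: "measure \<mu> (ifs_comp s u -` A) \<le> S" if "u \<in> words" for u
    unfolding S_def using that bdd by (intro cSUP_upper)
  have "measure \<mu> (ifs_comp s u -` A) \<le> (1 - weight w) * S" if u: "u \<in> words" for u
  proof -
    have "ifs_comp s w -` (ifs_comp s u -` A) \<inter> \<Gamma> = {}"
      using miss[OF u] by (auto simp: ifs_piece_append) (auto simp: ifs_piece_def)
    then have "measure \<mu> (ifs_comp s w -` (ifs_comp s u -` A)) = 0"
      by (rule measure_disjoint_attractor)
    moreover have "measure \<mu> (ifs_comp s v -` (ifs_comp s u -` A)) \<le> S" if "v \<in> words" for v
      using upper[of "u @ v"] u that by (simp add: ifs_comp_append vimage_comp)
    ultimately show ?thesis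
      using measure_le_along_word[OF w vimage_comp_borel[OF u A], of S] by simp
  qed
  then have "S \<le> (1 - weight w) * S"
    unfolding S_def[of] by (intro cSUP_least) (auto simp: S_def)
  then have "weight w * S \<le> 0" by (simp add: algebra_simps)
  then have "S \<le> 0" using weight_word_pos[OF w] by (simp add: mult_le_0_iff)
  then show ?thesis using upper[of "[]"] measure_nonneg[of \<mu> A] by (simp add: antisym)
qed

lemma null_if_null_preimages:
  assumes "A \<in> sets borel"
    and "\<And>u. u \<in> words \<Longrightarrow> length u = k \<Longrightarrow> measure \<mu> (ifs_comp s u -` A) = 0"
  shows "measure \<mu> A = 0"
  using assms
proof (induction k arbitrary: A)
  case 0
  show ?case using "0.prems"(2)[of "[]"] by simp
next
  case (Suc k)
  have "measure \<mu> (s m -` A) = 0" if m: "m \<in> {1..M}" for m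
  proof (rule Suc.IH)
    show "s m -` A \<in> sets borel" using vimage_comp_borel[of "[m]" A] m Suc.prems by simp
    show "measure \<mu> (ifs_comp s u -` (s m -` A)) = 0" if "u \<in> words" "length u = k" for u
      using Suc.prems(2)[of "m # u"] m that by (simp add: vimage_comp comp_def)
  qed
  then show ?case using self_similar[OF Suc.prems(1)] by simp
qed

lemma parallel_pieces_overlap_null:
  assumes v: "v \<in> words" "v' \<in> words" "v \<parallel> v'"
  shows "measure \<mu> (piece v \<inter> piece v') = 0"
proof -
  from isolating_word_avoids_overlap obtain w where w: "w \<in> words"
    and iso: "\<forall>v\<in>words. \<forall>v'\<in>words. v \<parallel> v' \<longrightarrow> (\<forall>u\<in>words.
      max (length v) (length v') \<le> length u \<longrightarrow> piece (u @ w) \<inter> (piece v \<inter> piece v') = {})"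
    by (rule bexE)
  note avoid = iso[rule_format, OF v]
  let ?A = "piece v \<inter> piece v'"
  have A: "?A \<in> sets borel" using piece_borel v by auto
  show ?thesis
  proof (rule null_if_null_preimages[OF A])
    fix t assume t: "t \<in> words" "length t = max (length v) (length v')"
    show "measure \<mu> (ifs_comp s t -` ?A) = 0"
    proof (rule null_if_preimages_miss_piece[OF w vimage_comp_borel[OF t(1) A]])
      fix u assume u: "u \<in> words"
      have "piece (t @ u @ w) \<inter> ?A = {}" using avoid[of "t @ u"] t u by simp
      then show "piece (u @ w) \<inter> ifs_comp s t -` ?A = {}"
        by (auto simp: ifs_piece_append[of s \<Gamma> t])
    qed
  qed
qed

section \<open>The index set of the cubature rule\<close>

lemma ifs_indices_eq_stopping:
  assumes "0 < h" "h < diameter \<Gamma>"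
  shows "ifs_indices M s \<Gamma> h = stopping (h / diameter \<Gamma>)"
proof -
  have d: "0 < diameter \<Gamma>" using assms by linarith
  have "diameter (piece w) \<le> h \<and> h < diameter (piece (butlast w)) \<longleftrightarrow>
      ratio w \<le> h / diameter \<Gamma> \<and> h / diameter \<Gamma> < ratio (butlast w)" if "w \<in> words" for w
  proof -
    have "butlast w \<in> words" using that by (auto dest: in_set_butlastD)
    then show ?thesis using that d by (simp add: diameter_piece pos_le_divide_eq pos_divide_less_eq)
  qed
  then show ?thesis using assms by (auto simp: ifs_indices_def stopping_def lists_eq_set)
qed

lemma indices_words: "0 < h \<Longrightarrow> w \<in> ifs_indices M s \<Gamma> h \<Longrightarrow> w \<in> words"
  using ifs_indices_eq_stopping[of h] stopping_words
  by (cases "h < diameter \<Gamma>") (auto simp: ifs_indices_def)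

lemma finite_indices: "0 < h \<Longrightarrow> finite (ifs_indices M s \<Gamma> h)"
  using ifs_indices_eq_stopping[of h] finite_stopping[of "h / diameter \<Gamma>"]
  by (cases "h < diameter \<Gamma>") (auto simp: ifs_indices_def)

lemma indices_diameter: "0 < h \<Longrightarrow> w \<in> ifs_indices M s \<Gamma> h \<Longrightarrow> diameter (piece w) \<le> h"
  by (auto simp: ifs_indices_def split: if_splits)

lemma indices_parallel:
  assumes "0 < h" "w \<in> ifs_indices M s \<Gamma> h" "w' \<in> ifs_indices M s \<Gamma> h" "w \<noteq> w'"
  shows "w \<parallel> w'"
proof (cases "h < diameter \<Gamma>")
  case True
  then show ?thesis using assms ifs_indices_eq_stopping stopping_parallel by simp
qed (use assms in \<open>auto simp: ifs_indices_def\<close>)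

lemma indices_cover:
  assumes "0 < h"
  shows "(\<Union>w\<in>ifs_indices M s \<Gamma> h. piece w) = \<Gamma>"
proof (cases "h < diameter \<Gamma>")
  case True
  have "\<Gamma> \<subseteq> (\<Union>w\<in>stopping (h / diameter \<Gamma>). piece w)"
  proof
    fix x assume "x \<in> \<Gamma>"
    then show "x \<in> (\<Union>w\<in>stopping (h / diameter \<Gamma>). piece w)"
      using stopping_cover[of "[]" x "h / diameter \<Gamma>"] assms True by auto
  qed
  then show ?thesis
    using ifs_indices_eq_stopping[OF assms True] stopping_words piece_subset_attractor by fastforce
qed (simp add: ifs_indices_def)

text \<open>Off the pairwise overlaps, which are null, every point of \<open>\<Gamma>\<close> lies in exactly one piece.\<close>

lemma AE_indicator_attractor_eq_sum:
  assumes h: "0 < h"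
  shows "AE x in \<mu>. indicator \<Gamma> x = (\<Sum>w\<in>ifs_indices M s \<Gamma> h. indicator (piece w) x :: real)"
proof -
  let ?L = "ifs_indices M s \<Gamma> h"
  have "AE x in \<mu>. \<forall>w\<in>?L. \<forall>w'\<in>?L. w \<noteq> w' \<longrightarrow> x \<notin> piece w \<inter> piece w'"
  proof (intro AE_finite_allI finite_indices[OF h] AE_impI)
    fix w w' assume w: "w \<in> ?L" "w' \<in> ?L" "w \<noteq> w'"
    have "piece w \<inter> piece w' \<in> null_sets \<mu>"
      using parallel_pieces_overlap_null[OF indices_words[OF h w(1)] indices_words[OF h w(2)]
          indices_parallel[OF h w]] piece_borel indices_words[OF h] w
      by (auto simp: null_sets_def emeasure_eq_measure sets_eq)
    then show "AE x in \<mu>. x \<notin> piece w \<inter> piece w'" by (rule AE_not_in)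
  qed
  then show ?thesis
  proof eventually_elim
    case (elim x)
    show ?case
    proof (cases "x \<in> \<Gamma>")
      case True
      then obtain w where w: "w \<in> ?L" "x \<in> piece w" using indices_cover[OF h] by blast
      have "(\<Sum>w\<in>?L. indicator (piece w) x :: real) = (\<Sum>w'\<in>{w}. indicator (piece w') x)"
        using elim w by (intro sum.mono_neutral_right finite_indices[OF h]) (auto simp: indicator_def)
      then show ?thesis using True w by simp
    next
      case False
      then have "x \<notin> piece w" if "w \<in> ?L" for w using indices_cover[OF h] that by blast
      then show ?thesis using False by simp
    qed
  qed
qed

lemma sum_measure_indices:
  assumes h: "0 < h"
  shows "(\<Sum>w\<in>ifs_indices M s \<Gamma> h. measure \<mu> (piece w)) = measure \<mu> \<Gamma>"
proof -
  have "measure \<mu> \<Gamma> = (\<integral>x. indicator \<Gamma> x \<partial>\<mu>)" by simp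
  also have "\<dots> = (\<integral>x. (\<Sum>w\<in>ifs_indices M s \<Gamma> h. indicator (piece w) x) \<partial>\<mu>)"
    using AE_indicator_attractor_eq_sum[OF h] piece_borel indices_words[OF h]
    by (intro integral_cong_AE) (auto simp: sets_eq intro!: borel_measurable_sum borel_measurable_indicator)
  also have "\<dots> = (\<Sum>w\<in>ifs_indices M s \<Gamma> h. measure \<mu> (piece w))"
    using piece_borel indices_words[OF h]
    by (subst Bochner_Integration.integral_sum) (auto simp: sets_eq emeasure_eq_measure)
  finally show ?thesis by simp
qed

end

section \<open>Symmetry of second derivatives\<close>

text \<open>The mixed second difference
  \<open>f (z + t u + t v) - f (z + t u) - f (z + t v) + f z\<close> is symmetric in \<open>u\<close> and \<open>v\<close>. By the mean value
  inequality along \<open>u\<close> it is \<open>t\<^sup>2 G v + o(t\<^sup>2)\<close>, where \<open>G\<close> is the derivative at \<open>z\<close> of the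
  directional derivative along \<open>u\<close>.\<close>

lemma second_difference_approx:
  fixes f :: "'a::real_normed_vector \<Rightarrow> 'b::real_normed_vector"
  assumes S: "open S" "z \<in> S" and f': "\<And>x. x \<in> S \<Longrightarrow> (f has_derivative f' x) (at x)"
    and G: "((\<lambda>x. f' x u) has_derivative G) (at z)" and "0 < \<epsilon>"
  shows "\<exists>\<delta>>0. \<forall>t. 0 < t \<and> t < \<delta> \<longrightarrow>
    norm (f (z + t *\<^sub>R u + t *\<^sub>R v) - f (z + t *\<^sub>R u) - f (z + t *\<^sub>R v) + f z - t\<^sup>2 *\<^sub>R G v) \<le> \<epsilon> * t\<^sup>2"
proof -
  (* bounds the norms of the two points t' u and t' u + t v, with 0 <= t' <= t, by t C in total *)
  define C where "C = 2 * norm u + norm v + 1"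
  have C: "0 < C" by (simp add: C_def add_nonneg_pos)
  obtain r where r: "0 < r" "ball z r \<subseteq> S" using S openE by blast
  have "0 < \<epsilon> / C" using C assms(5) by simp
  then obtain d where d: "0 < d" and
    rem: "\<And>y. norm (y - z) < d \<Longrightarrow> norm (f' y u - f' z u - G (y - z)) \<le> \<epsilon> / C * norm (y - z)"
    using G unfolding has_derivative_at_alt by blast
  define \<delta> where "\<delta> = min r d / C"
  have "norm (f (z + t *\<^sub>R u + t *\<^sub>R v) - f (z + t *\<^sub>R u) - f (z + t *\<^sub>R v) + f z - t\<^sup>2 *\<^sub>R G v) \<le> \<epsilon> * t\<^sup>2"
    if t: "0 < t" "t < \<delta>" for t
  proof -
    have tC: "t * C < r" "t * C < d" using t C by (auto simp: \<delta>_def pos_less_divide_eq)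
    have tu: "norm (\<tau> *\<^sub>R t *\<^sub>R u) \<le> t * norm u" if "0 \<le> \<tau>" "\<tau> \<le> 1" for \<tau>
      using that t mult_right_mono[of \<tau> 1 "t * norm u"] by simp
    have near: "norm (\<tau> *\<^sub>R t *\<^sub>R u) + norm (\<tau> *\<^sub>R t *\<^sub>R u + t *\<^sub>R v) \<le> t * C"
      if "0 \<le> \<tau>" "\<tau> \<le> 1" for \<tau>
    proof -
      have "norm (\<tau> *\<^sub>R t *\<^sub>R u + t *\<^sub>R v) \<le> t * norm u + t * norm v"
        using norm_triangle_le[OF add_mono[OF tu[OF that] order.refl[of "norm (t *\<^sub>R v)"]]] t by simp
      then show ?thesis using tu[OF that] t by (simp add: C_def algebra_simps)
    qed
    have in_S: "z + \<tau> *\<^sub>R t *\<^sub>R u + t *\<^sub>R v \<in> S" "z + \<tau> *\<^sub>R t *\<^sub>R u \<in> S" if "0 \<le> \<tau>" "\<tau> \<le> 1" for \<tau>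
    proof -
      have "norm (\<tau> *\<^sub>R t *\<^sub>R u) < r" "norm (\<tau> *\<^sub>R t *\<^sub>R u + t *\<^sub>R v) < r"
        using near[OF that] tC norm_ge_zero[of "\<tau> *\<^sub>R t *\<^sub>R u"] norm_ge_zero[of "\<tau> *\<^sub>R t *\<^sub>R u + t *\<^sub>R v"]
        by linarith+
      moreover have "dist z (z + w) = norm w" for w by (simp add: dist_norm)
      ultimately have "z + \<tau> *\<^sub>R t *\<^sub>R u + t *\<^sub>R v \<in> ball z r" "z + \<tau> *\<^sub>R t *\<^sub>R u \<in> ball z r"
        by (simp_all only: mem_ball add.assoc)
      then show "z + \<tau> *\<^sub>R t *\<^sub>R u + t *\<^sub>R v \<in> S" "z + \<tau> *\<^sub>R t *\<^sub>R u \<in> S" using r(2) by blast+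
    qed
    define g where "g \<tau> = f (z + \<tau> *\<^sub>R t *\<^sub>R u + t *\<^sub>R v) - f (z + \<tau> *\<^sub>R t *\<^sub>R u) - \<tau> *\<^sub>R t\<^sup>2 *\<^sub>R G v" for \<tau>
    define g' where "g' \<tau> = t *\<^sub>R (f' (z + \<tau> *\<^sub>R t *\<^sub>R u + t *\<^sub>R v) u - f' (z + \<tau> *\<^sub>R t *\<^sub>R u) u) - t\<^sup>2 *\<^sub>R G v" for \<tau>
    have deriv: "(g has_vector_derivative g' \<tau>) (at \<tau>)" if \<tau>: "0 \<le> \<tau>" "\<tau> \<le> 1" for \<tau>
    proof -
      have 1: "((\<lambda>\<tau>. f (z + \<tau> *\<^sub>R t *\<^sub>R u + t *\<^sub>R v)) has_derivative
          (\<lambda>x. f' (z + \<tau> *\<^sub>R t *\<^sub>R u + t *\<^sub>R v) (x *\<^sub>R t *\<^sub>R u))) (at \<tau>)"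
        by (rule has_derivative_compose[of "\<lambda>\<tau>. z + \<tau> *\<^sub>R t *\<^sub>R u + t *\<^sub>R v" "\<lambda>x. x *\<^sub>R t *\<^sub>R u", OF _ f'[OF in_S(1)[OF \<tau>]]])
           (auto intro!: derivative_eq_intros)
      have 2: "((\<lambda>\<tau>. f (z + \<tau> *\<^sub>R t *\<^sub>R u)) has_derivative
          (\<lambda>x. f' (z + \<tau> *\<^sub>R t *\<^sub>R u) (x *\<^sub>R t *\<^sub>R u))) (at \<tau>)"
        by (rule has_derivative_compose[of "\<lambda>\<tau>. z + \<tau> *\<^sub>R t *\<^sub>R u" "\<lambda>x. x *\<^sub>R t *\<^sub>R u", OF _ f'[OF in_S(2)[OF \<tau>]]])
           (auto intro!: derivative_eq_intros)
      have lin: "linear (f' x)" if "x \<in> S" for x using f'[OF that] has_derivative_linear by blast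
      have "(g has_derivative (\<lambda>x. f' (z + \<tau> *\<^sub>R t *\<^sub>R u + t *\<^sub>R v) (x *\<^sub>R t *\<^sub>R u)
          - f' (z + \<tau> *\<^sub>R t *\<^sub>R u) (x *\<^sub>R t *\<^sub>R u) - x *\<^sub>R t\<^sup>2 *\<^sub>R G v)) (at \<tau>)"
        unfolding g_def by (intro derivative_intros 1 2)
      then show ?thesis
        unfolding has_vector_derivative_def g'_def
        by (simp add: linear_scale[OF lin[OF in_S(1)[OF \<tau>]]] linear_scale[OF lin[OF in_S(2)[OF \<tau>]]]
              scaleR_diff_right del: scaleR_scaleR)
    qed
    have bound: "norm (g' \<tau>) \<le> \<epsilon> * t\<^sup>2" if \<tau>: "0 \<le> \<tau>" "\<tau> \<le> 1" for \<tau>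
    proof -
      define a where "a = \<tau> *\<^sub>R t *\<^sub>R u"
      define b where "b = a + t *\<^sub>R v"
      have ab: "norm a + norm b \<le> t * C" using near[OF \<tau>] by (simp only: a_def b_def)
      then have "norm a < d" "norm b < d" using tC norm_ge_zero[of a] norm_ge_zero[of b] by linarith+
      then have R: "norm (f' (z + a) u - f' z u - G a) \<le> \<epsilon> / C * norm a"
          "norm (f' (z + b) u - f' z u - G b) \<le> \<epsilon> / C * norm b"
        using rem[of "z + a"] rem[of "z + b"] by simp_all
      have linG: "linear G" using G has_derivative_linear by blast
      have Gab: "G b - G a = t *\<^sub>R G v" by (simp add: b_def linear_add[OF linG] linear_scale[OF linG])
      have "z + \<tau> *\<^sub>R t *\<^sub>R u + t *\<^sub>R v = z + b" "z + \<tau> *\<^sub>R t *\<^sub>R u = z + a"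
        by (simp_all only: a_def b_def add.assoc)
      then have "g' \<tau> = t *\<^sub>R (f' (z + b) u - f' (z + a) u) - t *\<^sub>R (G b - G a)"
        unfolding g'_def Gab by (simp only: power2_eq_square scaleR_scaleR[of t t])
      also have "\<dots> = t *\<^sub>R ((f' (z + b) u - f' z u - G b) - (f' (z + a) u - f' z u - G a))"
        by (simp only: scaleR_diff_right[symmetric]) simp
      finally have "g' \<tau> = t *\<^sub>R ((f' (z + b) u - f' z u - G b) - (f' (z + a) u - f' z u - G a))" .
      then have "norm (g' \<tau>) \<le> t * (norm (f' (z + b) u - f' z u - G b) + norm (f' (z + a) u - f' z u - G a))"
        using mult_left_mono[OF norm_triangle_ineq4 less_imp_le[OF t(1)]] t by (simp only: norm_scaleR abs_of_pos)
      also have "\<dots> \<le> t * (\<epsilon> / C * norm b + \<epsilon> / C * norm a)"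
        using R t by (intro mult_left_mono add_mono) auto
      also have "\<dots> = t * (\<epsilon> / C) * (norm a + norm b)"
        by (simp only: distrib_left add.commute mult.assoc)
      also have "\<dots> \<le> t * (\<epsilon> / C) * (t * C)"
        using t C assms(5) by (intro mult_left_mono[OF ab]) simp
      also have "\<dots> = \<epsilon> * t\<^sup>2" using C by (simp add: power2_eq_square)
      finally show ?thesis .
    qed
    have "norm (g 1 - g 0) \<le> \<epsilon> * t\<^sup>2 * 1 - \<epsilon> * t\<^sup>2 * 0"
    proof (rule differentiable_bound_general[where f = g and f' = g' and \<phi> = "\<lambda>\<tau>. \<epsilon> * t\<^sup>2 * \<tau>" and \<phi>' = "\<lambda>_. \<epsilon> * t\<^sup>2"])
      show "continuous_on {0..1} g"
        using deriv has_vector_derivative_continuous by (intro continuous_at_imp_continuous_on) force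
      show "((\<lambda>\<tau>. \<epsilon> * t\<^sup>2 * \<tau>) has_vector_derivative \<epsilon> * t\<^sup>2) (at x)" for x
        unfolding has_real_derivative_iff_has_vector_derivative[symmetric]
        by (auto intro!: derivative_eq_intros)
    qed (auto intro!: continuous_intros deriv bound)
    then show ?thesis by (simp add: g_def algebra_simps)
  qed
  moreover have "0 < \<delta>" using r(1) d C by (simp add: \<delta>_def)
  ultimately show ?thesis by blast
qed

lemma second_derivative_symmetric:
  fixes f :: "'a::real_normed_vector \<Rightarrow> 'b::real_normed_vector"
  assumes S: "open S" "z \<in> S" and f': "\<And>x. x \<in> S \<Longrightarrow> (f has_derivative f' x) (at x)"
    and G: "((\<lambda>x. f' x u) has_derivative G) (at z)" and H: "((\<lambda>x. f' x v) has_derivative H) (at z)"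
  shows "G v = H u"
proof -
  have "norm (G v - H u) \<le> 0 + \<epsilon>" if "0 < \<epsilon>" for \<epsilon>
  proof -
    let ?\<Delta> = "\<lambda>t. f (z + t *\<^sub>R u + t *\<^sub>R v) - f (z + t *\<^sub>R u) - f (z + t *\<^sub>R v) + f z"
    have "0 < \<epsilon> / 2" using that by simp
    obtain \<delta>1 where 1: "0 < \<delta>1" "\<And>t. 0 < t \<Longrightarrow> t < \<delta>1 \<Longrightarrow> norm (?\<Delta> t - t\<^sup>2 *\<^sub>R G v) \<le> \<epsilon> / 2 * t\<^sup>2"
      using second_difference_approx[OF S f' G \<open>0 < \<epsilon> / 2\<close>, of v] by auto
    obtain \<delta>2 where 2: "0 < \<delta>2" "\<And>t. 0 < t \<Longrightarrow> t < \<delta>2 \<Longrightarrow>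
        norm (f (z + t *\<^sub>R v + t *\<^sub>R u) - f (z + t *\<^sub>R v) - f (z + t *\<^sub>R u) + f z - t\<^sup>2 *\<^sub>R H u) \<le> \<epsilon> / 2 * t\<^sup>2"
      using second_difference_approx[OF S f' H \<open>0 < \<epsilon> / 2\<close>, of u] by auto
    define t where "t = min \<delta>1 \<delta>2 / 2"
    have t: "0 < t" "t < \<delta>1" "t < \<delta>2" using 1(1) 2(1) by (auto simp: t_def)
    have "norm (?\<Delta> t - t\<^sup>2 *\<^sub>R H u) \<le> \<epsilon> / 2 * t\<^sup>2"
      using 2(2)[OF t(1,3)] by (simp add: algebra_simps)
    then have "norm ((?\<Delta> t - t\<^sup>2 *\<^sub>R H u) - (?\<Delta> t - t\<^sup>2 *\<^sub>R G v)) \<le> \<epsilon> / 2 * t\<^sup>2 + \<epsilon> / 2 * t\<^sup>2"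
      by (rule order_trans[OF norm_triangle_ineq4 add_mono[OF _ 1(2)[OF t(1,2)]]])
    moreover have "(?\<Delta> t - t\<^sup>2 *\<^sub>R H u) - (?\<Delta> t - t\<^sup>2 *\<^sub>R G v) = t\<^sup>2 *\<^sub>R (G v - H u)"
      by (simp add: algebra_simps)
    ultimately have "norm (t\<^sup>2 *\<^sub>R (G v - H u)) \<le> \<epsilon> / 2 * t\<^sup>2 + \<epsilon> / 2 * t\<^sup>2" by (simp only:)
    then have "t\<^sup>2 * norm (G v - H u) \<le> t\<^sup>2 * \<epsilon>" unfolding norm_scaleR by (simp add: mult.commute)
    then show ?thesis using t(1) by simp
  qed
  then have "norm (G v - H u) \<le> 0" by (rule field_le_epsilon)
  then show ?thesis by simp
qed

section \<open>Gradient and Hessian in coordinates\<close>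

definition coords :: "(real^'n::finite) \<times> (real^'k::finite) \<Rightarrow> real^('n + 'k)" where
  "coords z = (\<chi> c. case c of Inl i \<Rightarrow> fst z $ i | Inr j \<Rightarrow> snd z $ j)"

lemma sum_UNIV_Plus:
  fixes g :: "'n::finite + 'k::finite \<Rightarrow> 'a::comm_monoid_add"
  shows "(\<Sum>c\<in>UNIV. g c) = (\<Sum>i\<in>UNIV. g (Inl i)) + (\<Sum>j\<in>UNIV. g (Inr j))"
  by (simp add: UNIV_Plus_UNIV[symmetric] sum.Plus del: UNIV_Plus_UNIV)

lemma norm_coords [simp]: "norm (coords z) = norm z"
  by (simp add: norm_vec_def L2_set_def norm_prod_def coords_def sum_UNIV_Plus real_sqrt_pow2 sum_nonneg)

lemma coords_expansion: "z = (\<Sum>c\<in>UNIV. coords z $ c *\<^sub>R coord_vec c)"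
proof -
  have "(\<Sum>i\<in>UNIV. (fst z $ i) *\<^sub>R axis i (1::real)) = fst z" "(\<Sum>j\<in>UNIV. (snd z $ j) *\<^sub>R axis j (1::real)) = snd z"
    by (simp_all add: basis_expansion scalar_mult_eq_scaleR[symmetric])
  then show ?thesis
    by (intro prod_eqI)
       (simp_all add: coords_def coord_vec_def sum_UNIV_Plus fst_sum snd_sum)
qed

text \<open>The real-linear form with coefficient vector \<open>g\<close>, that is, \<open>g \<bullet> v\<close> without conjugation.\<close>

definition linear_form :: "complex^('n + 'k) \<Rightarrow> (real^'n::finite) \<times> (real^'k::finite) \<Rightarrow> complex" where
  "linear_form g v = (\<Sum>c\<in>UNIV. coords v $ c *\<^sub>R g $ c)"

lemma norm_scaleR_sum_le:
  fixes x :: "real^'c" and g :: "'a::real_normed_vector^'c"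
  shows "norm (\<Sum>c\<in>UNIV. x $ c *\<^sub>R g $ c) \<le> norm x * norm g"
proof -
  have "norm (\<Sum>c\<in>UNIV. x $ c *\<^sub>R g $ c) \<le> (\<Sum>c\<in>UNIV. \<bar>norm (x $ c)\<bar> * \<bar>norm (g $ c)\<bar>)"
    by (rule order_trans[OF norm_sum]) simp
  also have "\<dots> \<le> L2_set (\<lambda>c. norm (x $ c)) UNIV * L2_set (\<lambda>c. norm (g $ c)) UNIV"
    by (rule L2_set_mult_ineq)
  finally show ?thesis by (simp add: norm_vec_def)
qed

lemma norm_linear_form_le: "norm (linear_form g v) \<le> norm g * norm v"
  using norm_scaleR_sum_le[of "coords v" g] by (simp add: linear_form_def mult.commute)

lemma linear_form_diff: "linear_form (g - g') v = linear_form g v - linear_form g' v"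
  by (simp add: linear_form_def scaleR_diff_right sum_subtractf)

lemma linear_form_coord_vec [simp]: "linear_form g (coord_vec c) = g $ c"
proof -
  have "coords (coord_vec c :: (real^'a) \<times> (real^'b)) $ d = (if d = c then 1 else 0)" for d
    by (cases c; cases d) (auto simp: coords_def coord_vec_def axis_def)
  then have "linear_form g (coord_vec c) = (\<Sum>d\<in>UNIV. if d = c then g $ d else 0)"
    unfolding linear_form_def by (intro sum.cong) auto
  then show ?thesis by simp
qed

lemma bounded_linear_linear_form: "bounded_linear (linear_form g)"
  unfolding linear_form_def coords_def
proof (intro bounded_linear_sum bounded_linear_scaleR_const)
  fix c :: "'a + 'b"
  show "bounded_linear (\<lambda>z. (\<chi> c. case c of Inl i \<Rightarrow> fst z $ i | Inr j \<Rightarrow> snd z $ j) $ c :: real)"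
    by (cases c) (auto intro!: bounded_linear_intros bounded_linear_compose[OF bounded_linear_vec_nth])
qed

lemma bounded_linear_eq_linear_form:
  assumes "bounded_linear F"
  shows "F v = linear_form (\<chi> c. F (coord_vec c)) v"
proof -
  have "F v = F (\<Sum>c\<in>UNIV. coords v $ c *\<^sub>R coord_vec c)"
    by (rule arg_cong[OF coords_expansion])
  then show ?thesis
    using assms by (simp add: linear_form_def linear_sum linear_scale bounded_linear.linear)
qed

lemma partial_deriv_eq:
  assumes "(f has_derivative F) (at z)"
  shows "partial_deriv c f z = F (coord_vec c)"
proof -
  have "((\<lambda>t. f (z + t *\<^sub>R coord_vec c)) has_derivative (\<lambda>t. F (t *\<^sub>R coord_vec c))) (at 0)"
    by (rule has_derivative_compose[of "\<lambda>t. z + t *\<^sub>R coord_vec c" "\<lambda>t. t *\<^sub>R coord_vec c"])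
       (auto intro!: derivative_eq_intros simp: assms)
  then have "((\<lambda>t. f (z + t *\<^sub>R coord_vec c)) has_vector_derivative F (coord_vec c)) (at 0)"
    using linear_scale[OF has_derivative_linear[OF assms]] by (simp add: has_vector_derivative_def)
  then show ?thesis unfolding partial_deriv_def by (rule vector_derivative_at)
qed

lemma has_derivative_gradient:
  assumes "f differentiable (at z)"
  shows "(f has_derivative linear_form (gradient f z)) (at z)"
proof -
  obtain F where F: "(f has_derivative F) (at z)" using assms by (auto simp: differentiable_def)
  have "gradient f z = (\<chi> c. F (coord_vec c))"
    by (simp add: gradient_def partial_deriv_eq[OF F])
  then have "linear_form (gradient f z) = F"
    by (intro ext) (simp only: bounded_linear_eq_linear_form[OF has_derivative_bounded_linear[OF F], symmetric])
  then show ?thesis using F by simp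
qed

lemma has_derivative_vec_nth:
  assumes "(g has_derivative G) F"
  shows "((\<lambda>x. g x $ c) has_derivative (\<lambda>v. G v $ c)) F"
  using bounded_linear.has_derivative[OF bounded_linear_vec_nth assms] .

lemma hessian_entry:
  assumes "(gradient f has_derivative G) (at z)"
  shows "hessian f z $ c $ d = G (coord_vec c) $ d"
proof -
  have "(partial_deriv d f has_derivative (\<lambda>v. G v $ d)) (at z)"
    using has_derivative_vec_nth[OF assms, of d] by (simp add: gradient_def)
  then show ?thesis by (simp add: hessian_def partial_deriv_eq)
qed

lemma hessian_symmetric:
  assumes "open S" "z \<in> S" "twice_differentiable_on f S"
  shows "hessian f z $ c $ d = hessian f z $ d $ c"
proof -
  have df: "f differentiable (at x)" if "x \<in> S" for x
    using assms that by (auto simp: twice_differentiable_on_def differentiable_on_eq_differentiable_at)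
  obtain G where G: "(gradient f has_derivative G) (at z)"
    using assms by (auto simp: twice_differentiable_on_def differentiable_on_eq_differentiable_at differentiable_def)
  have "((\<lambda>x. linear_form (gradient f x) (coord_vec e)) has_derivative (\<lambda>v. G v $ e)) (at z)" for e
    using has_derivative_vec_nth[OF G, of e] by simp
  from second_derivative_symmetric[OF assms(1,2) has_derivative_gradient[OF df] this this]
  have "G (coord_vec d) $ c = G (coord_vec c) $ d" .
  then show ?thesis by (simp add: hessian_entry[OF G])
qed

lemma bounded_linear_matrix_vector_mult_complex:
  "bounded_linear (\<lambda>v::complex^'c. A *v v :: complex^'d)"
proof -
  have "linear (\<lambda>v. A *v v)"
    by (intro linearI) (simp_all add: vec_eq_iff matrix_vector_mult_def scaleR_sum_right sum.distrib distrib_left)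
  then show ?thesis by (simp add: linear_conv_bounded_linear)
qed

text \<open>Differentiating the gradient in direction \<open>v\<close> gives the transposed Hessian applied to \<open>v\<close>;
  symmetry removes the transposition.\<close>

lemma norm_gradient_derivative_le:
  assumes "open S" "z \<in> S" "twice_differentiable_on f S" "(gradient f has_derivative G) (at z)"
  shows "norm (G v) \<le> matrix_norm2 (hessian f z) * norm v"
proof -
  let ?v = "(\<chi> c. complex_of_real (coords v $ c)) :: complex^('a + 'b)"
  have "G v $ d = (hessian f z *v ?v) $ d" for d
  proof -
    have "bounded_linear (\<lambda>v. G v $ d)"
      using has_derivative_bounded_linear[OF has_derivative_vec_nth[OF assms(4)]] .
    from bounded_linear_eq_linear_form[OF this, of v]
    have "G v $ d = (\<Sum>c\<in>UNIV. coords v $ c *\<^sub>R hessian f z $ c $ d)"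
      by (simp add: linear_form_def hessian_entry[OF assms(4)])
    also have "\<dots> = (hessian f z *v ?v) $ d"
    proof -
      have "coords v $ c *\<^sub>R hessian f z $ c $ d = hessian f z $ d $ c * complex_of_real (coords v $ c)" for c
        by (subst hessian_symmetric[OF assms(1-3)]) (simp add: scaleR_conv_of_real)
      then show ?thesis by (simp add: matrix_vector_mult_def)
    qed
    finally show ?thesis .
  qed
  then have "G v = hessian f z *v ?v" by (simp add: vec_eq_iff)
  moreover have "norm ?v = norm v"
    using norm_coords[of v] by (simp add: norm_vec_def)
  ultimately show ?thesis
    using onorm[OF bounded_linear_matrix_vector_mult_complex, of "hessian f z" ?v]
    by (simp add: matrix_norm2_def)
qed

section \<open>Taylor remainders on convex sets\<close>

lemma mean_value_gradient_bound:
  assumes "convex S" "b \<in> S" "z \<in> S" and f: "\<And>x. x \<in> S \<Longrightarrow> f differentiable (at x)"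
    and B: "\<And>x. x \<in> S \<Longrightarrow> norm (gradient f x) \<le> B"
  shows "norm (f z - f b) \<le> B * norm (z - b)"
proof (rule differentiable_bound[OF assms(1) _ _ assms(3,2)])
  fix x assume x: "x \<in> S"
  show "(f has_derivative linear_form (gradient f x)) (at x within S)"
    using has_derivative_gradient[OF f[OF x]] by (rule has_derivative_at_withinI)
  show "onorm (linear_form (gradient f x)) \<le> B"
    by (intro onorm_le order_trans[OF norm_linear_form_le] mult_right_mono B[OF x] norm_ge_zero)
qed

text \<open>Along the segment from \<open>b\<close> the remainder has derivative at most \<open>t l |z - b|\<^sup>2\<close>, which
  integrates to the factor \<open>1 / 2\<close>.\<close>

lemma taylor_remainder_lipschitz_gradient:
  assumes "convex S" "b \<in> S" "z \<in> S" and f: "\<And>x. x \<in> S \<Longrightarrow> f differentiable (at x)"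
    and lip: "\<And>x. x \<in> S \<Longrightarrow> norm (gradient f x - gradient f b) \<le> l * norm (x - b)"
  shows "norm (f z - f b - linear_form (gradient f b) (z - b)) \<le> l / 2 * (norm (z - b))\<^sup>2"
proof -
  define v where "v = z - b"
  define g where "g t = f (b + t *\<^sub>R v) - t *\<^sub>R linear_form (gradient f b) v" for t
  define g' where "g' t = linear_form (gradient f (b + t *\<^sub>R v)) v - linear_form (gradient f b) v" for t
  have in_S: "b + t *\<^sub>R v \<in> S" if "0 \<le> t" "t \<le> 1" for t
  proof -
    have "b + t *\<^sub>R v = (1 - t) *\<^sub>R b + t *\<^sub>R z" by (simp add: v_def algebra_simps)
    then show ?thesis using convexD_alt[OF assms(1-3) that] by simp
  qed
  have deriv: "(g has_vector_derivative g' t) (at t)" if t: "0 \<le> t" "t \<le> 1" for t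
  proof -
    let ?F = "linear_form (gradient f (b + t *\<^sub>R v))"
    have "((\<lambda>t. f (b + t *\<^sub>R v)) has_derivative (\<lambda>x. ?F (x *\<^sub>R v))) (at t)"
      by (rule has_derivative_compose[of "\<lambda>t. b + t *\<^sub>R v" "\<lambda>x. x *\<^sub>R v", OF _ has_derivative_gradient[OF f[OF in_S[OF t]]]])
         (auto intro!: derivative_eq_intros)
    then have "(g has_derivative (\<lambda>x. ?F (x *\<^sub>R v) - x *\<^sub>R linear_form (gradient f b) v)) (at t)"
      unfolding g_def by (intro derivative_intros)
    then show ?thesis
      unfolding has_vector_derivative_def g'_def
      by (simp add: linear_scale[OF bounded_linear.linear[OF bounded_linear_linear_form]] scaleR_diff_right)
  qed
  have bound: "norm (g' t) \<le> l * (norm v)\<^sup>2 * t" if t: "0 \<le> t" "t \<le> 1" for t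
  proof -
    have "norm (g' t) \<le> norm (gradient f (b + t *\<^sub>R v) - gradient f b) * norm v"
      unfolding g'_def linear_form_diff[symmetric] by (rule norm_linear_form_le)
    also have "\<dots> \<le> l * norm (t *\<^sub>R v) * norm v"
      using lip[OF in_S[OF t]] by (intro mult_right_mono) auto
    finally show ?thesis using t by (simp add: power2_eq_square algebra_simps)
  qed
  have "norm (g 1 - g 0) \<le> l / 2 * (norm v)\<^sup>2 * 1\<^sup>2 - l / 2 * (norm v)\<^sup>2 * 0\<^sup>2"
  proof (rule differentiable_bound_general[where f = g and f' = g'
        and \<phi> = "\<lambda>t. l / 2 * (norm v)\<^sup>2 * t\<^sup>2" and \<phi>' = "\<lambda>t. l * (norm v)\<^sup>2 * t"])
    show "continuous_on {0..1} g"
      using deriv has_vector_derivative_continuous by (intro continuous_at_imp_continuous_on) force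
    show "((\<lambda>t. l / 2 * (norm v)\<^sup>2 * t\<^sup>2) has_vector_derivative l * (norm v)\<^sup>2 * t) (at t)" for t
      unfolding has_real_derivative_iff_has_vector_derivative[symmetric]
      by (auto intro!: derivative_eq_intros)
  qed (auto intro!: continuous_intros deriv bound)
  moreover have "g 1 - g 0 = f z - f b - linear_form (gradient f b) (z - b)"
    by (simp add: g_def v_def)
  ultimately show ?thesis by (simp add: v_def)
qed

lemma gradient_lipschitz_hessian:
  assumes "open \<Omega>" "S \<subseteq> \<Omega>" "twice_differentiable_on f \<Omega>" "convex S" "b \<in> S" "z \<in> S"
    and B: "\<And>x. x \<in> S \<Longrightarrow> matrix_norm2 (hessian f x) \<le> B"
  shows "norm (gradient f z - gradient f b) \<le> B * norm (z - b)"
proof -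
  have "\<exists>G. (gradient f has_derivative G) (at x)" if "x \<in> S" for x
    using assms that
    by (auto simp: twice_differentiable_on_def differentiable_on_eq_differentiable_at differentiable_def)
  then obtain G where G: "\<And>x. x \<in> S \<Longrightarrow> (gradient f has_derivative G x) (at x)" by metis
  show ?thesis
  proof (rule differentiable_bound[OF assms(4) _ _ assms(6,5)])
    fix x assume x: "x \<in> S"
    show "(gradient f has_derivative G x) (at x within S)"
      using G[OF x] by (rule has_derivative_at_withinI)
    show "onorm (G x) \<le> B"
    proof (rule onorm_le)
      fix v
      have "norm (G x v) \<le> matrix_norm2 (hessian f x) * norm v"
        using norm_gradient_derivative_le[OF assms(1) _ assms(3) G[OF x]] x assms(2) by blast
      also have "\<dots> \<le> B * norm v" using B[OF x] by (intro mult_right_mono) auto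
      finally show "norm (G x v) \<le> B * norm v" .
    qed
  qed
qed


section \<open>Norms of gradient and Hessian in terms of partial derivatives\<close>

lemma norm_vec_le_max:
  fixes g :: "'a::real_normed_vector^'c"
  assumes "\<And>c. norm (g $ c) \<le> m"
  shows "norm g \<le> sqrt (real CARD('c)) * m"
proof -
  have "0 \<le> m" using assms norm_ge_zero order_trans by blast
  moreover have "norm g \<le> L2_set (\<lambda>_. m) (UNIV :: 'c set)"
    unfolding norm_vec_def using assms by (intro L2_set_mono) auto
  ultimately show ?thesis by (simp add: L2_set_constant)
qed

lemma matrix_norm2_le_max:
  fixes A :: "complex^'c^'c"
  assumes "\<And>c d. cmod (A $ c $ d) \<le> m"
  shows "matrix_norm2 A \<le> real CARD('c) * m"
  unfolding matrix_norm2_def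
proof (rule onorm_le)
  fix v :: "complex^'c"
  have m: "0 \<le> m" using assms norm_ge_zero order_trans by blast
  have "cmod ((A *v v) $ c) \<le> sqrt (real CARD('c)) * m * norm v" for c
  proof -
    have "cmod ((A *v v) $ c) \<le> (\<Sum>d\<in>UNIV. cmod (A $ c $ d * v $ d))"
      unfolding matrix_vector_mult_def by (simp add: norm_sum)
    also have "\<dots> \<le> (\<Sum>d\<in>UNIV. \<bar>m\<bar> * \<bar>cmod (v $ d)\<bar>)"
      using assms m by (intro sum_mono) (simp add: norm_mult mult_right_mono)
    also have "\<dots> \<le> L2_set (\<lambda>_. m) (UNIV :: 'c set) * L2_set (\<lambda>d. cmod (v $ d)) UNIV"
      by (rule L2_set_mult_ineq)
    finally show ?thesis using m by (simp add: L2_set_constant norm_vec_def)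
  qed
  then have "norm (A *v v) \<le> sqrt (real CARD('c)) * (sqrt (real CARD('c)) * m * norm v)"
    by (rule norm_vec_le_max)
  then show "norm (A *v v) \<le> real CARD('c) * m * norm v"
    by (simp add: mult.assoc[symmetric])
qed

lemma coord_enum: "distinct (coord_enum :: 'c::finite list)" "set (coord_enum :: 'c list) = UNIV"
proof -
  have "\<exists>cs :: 'c list. distinct cs \<and> set cs = UNIV"
    using finite_distinct_list[of "UNIV :: 'c set"] by auto
  then have "distinct (coord_enum :: 'c list) \<and> set (coord_enum :: 'c list) = UNIV"
    unfolding coord_enum_def by (rule someI_ex)
  then show "distinct (coord_enum :: 'c::finite list)" "set (coord_enum :: 'c list) = UNIV" by auto
qed

lemma foldr_funpow_zero:
  "(\<And>c. c \<in> set cs \<Longrightarrow> \<alpha> c = (0::nat)) \<Longrightarrow> foldr (\<lambda>c. F c ^^ \<alpha> c) cs f = f"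
  by (induction cs) auto

lemma finite_multi_indices: "finite (multi_indices r :: ('c::finite \<Rightarrow> nat) set)"
proof (rule finite_subset)
  show "multi_indices r \<subseteq> (UNIV :: 'c set) \<rightarrow>\<^sub>E {..r}"
    by (auto simp: multi_indices_def intro: member_le_sum)
qed (simp add: finite_PiE)

lemma multi_deriv_order_1: "\<exists>\<alpha>\<in>multi_indices 1. multi_deriv \<alpha> f = partial_deriv c f"
proof -
  define \<alpha> where "\<alpha> e = (if e = c then 1 else 0 :: nat)" for e
  obtain xs ys where xy: "coord_enum = xs @ c # ys"
    using split_list[of c coord_enum] coord_enum(2) by auto
  have "distinct (xs @ c # ys)" unfolding xy[symmetric] by (rule coord_enum(1))
  then have "c \<notin> set xs" "c \<notin> set ys" by auto
  then have "foldr (\<lambda>c. partial_deriv c ^^ \<alpha> c) xs g = g" "foldr (\<lambda>c. partial_deriv c ^^ \<alpha> c) ys g = g" for g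
    by (auto intro!: foldr_funpow_zero simp: \<alpha>_def)
  then have "multi_deriv \<alpha> f = partial_deriv c f" by (simp add: multi_deriv_def xy) (simp add: \<alpha>_def)
  moreover have "\<alpha> \<in> multi_indices 1" by (simp add: multi_indices_def \<alpha>_def)
  ultimately show ?thesis by blast
qed

text \<open>Which of the two mixed derivatives arises depends on the order of \<open>c\<close> and \<open>d\<close> in the chosen
  enumeration of the coordinates.\<close>

lemma multi_deriv_order_2:
  "\<exists>\<alpha>\<in>multi_indices 2. multi_deriv \<alpha> f = partial_deriv c (partial_deriv d f) \<or>
     multi_deriv \<alpha> f = partial_deriv d (partial_deriv c f)"
proof -
  define \<alpha> where "\<alpha> e = (if e = c then 1 else 0 :: nat) + (if e = d then 1 else 0)" for e
  have \<alpha>: "\<alpha> \<in> multi_indices 2" by (simp add: multi_indices_def \<alpha>_def sum.distrib)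
  let ?D = "foldr (\<lambda>c. partial_deriv c ^^ \<alpha> c)"
  have id: "?D xs g = g" if "c \<notin> set xs" "d \<notin> set xs" for xs g
    using that by (auto intro!: foldr_funpow_zero simp: \<alpha>_def)
  obtain xs ys where xy: "coord_enum = xs @ c # ys"
    using split_list[of c coord_enum] coord_enum(2) by auto
  have "distinct (xs @ c # ys)" unfolding xy[symmetric] by (rule coord_enum(1))
  then have dist: "c \<notin> set xs" "c \<notin> set ys" "distinct xs" "distinct ys" "set xs \<inter> set ys = {}"
    by auto
  consider "d = c" | "d \<noteq> c" "d \<in> set ys" | "d \<noteq> c" "d \<in> set xs"
    using coord_enum(2) xy by (metis UNIV_I Un_iff set_ConsD set_append)
  then have "multi_deriv \<alpha> f = partial_deriv c (partial_deriv d f) \<or>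
     multi_deriv \<alpha> f = partial_deriv d (partial_deriv c f)"
  proof cases
    case 1
    then have "\<alpha> c = 2" by (simp add: \<alpha>_def)
    then show ?thesis
      using 1 dist by (simp add: multi_deriv_def xy id numeral_2_eq_2)
  next
    case 2
    obtain as bs where ab: "ys = as @ d # bs" using split_list[OF 2(2)] by blast
    then have "d \<notin> set as" "d \<notin> set bs" "d \<notin> set xs" using dist by auto
    moreover have "\<alpha> c = 1" "\<alpha> d = 1" using 2 by (simp_all add: \<alpha>_def)
    ultimately show ?thesis using dist ab by (simp add: multi_deriv_def xy id)
  next
    case 3
    obtain as bs where ab: "xs = as @ d # bs" using split_list[OF 3(2)] by blast
    then have "d \<notin> set as" "d \<notin> set bs" "d \<notin> set ys" using dist by auto
    moreover have "\<alpha> c = 1" "\<alpha> d = 1" using 3 by (simp_all add: \<alpha>_def)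
    ultimately show ?thesis using dist ab by (simp add: multi_deriv_def xy id)
  qed
  then show ?thesis using \<alpha> by blast
qed

section \<open>Barycentres\<close>

lemma finite_measure_integrable_indicator:
  fixes g :: "'a::topological_space \<Rightarrow> 'b::{banach, second_countable_topology}"
  assumes "finite_measure \<mu>" "sets \<mu> = sets borel" "S \<in> sets borel"
    and meas: "(\<lambda>x. indicator S x *\<^sub>R g x) \<in> borel_measurable borel"
    and bound: "\<And>x. x \<in> S \<Longrightarrow> norm (g x) \<le> B"
  shows "integrable \<mu> (\<lambda>x. indicator S x *\<^sub>R g x)"
proof -
  interpret finite_measure \<mu> by fact
  have "norm (indicator S x *\<^sub>R g x) \<le> \<bar>B\<bar>" for x
    using bound[of x] by (auto simp: indicator_def)
  then show ?thesis
    using meas assms(2) by (intro integrable_const_bound[of _ "\<bar>B\<bar>"]) (auto cong: measurable_cong_sets)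
qed

lemma integrable_compact_continuous:
  fixes g :: "'a::{t2_space} \<Rightarrow> 'b::{banach, second_countable_topology}"
  assumes "finite_measure \<mu>" "sets \<mu> = sets borel" "compact S" "continuous_on S g"
  shows "integrable \<mu> (\<lambda>x. indicator S x *\<^sub>R g x)"
proof -
  obtain B where "\<And>x. x \<in> S \<Longrightarrow> norm (g x) \<le> B"
    using compact_imp_bounded[OF compact_continuous_image[OF assms(4,3)]] unfolding bounded_iff by auto
  then show ?thesis
    using assms by (intro finite_measure_integrable_indicator borel_measurable_continuous_on_indicator)
                   (auto simp: borel_compact)
qed

lemma barycentre_moment:
  fixes \<mu> :: "(real^'n) measure"
  assumes "finite_measure \<mu>" "sets \<mu> = sets borel" "compact S" "0 < measure \<mu> S"
  shows "(\<integral>x. indicator S x *\<^sub>R (x - barycentre \<mu> S) \<partial>\<mu>) = 0"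
proof -
  interpret finite_measure \<mu> by fact
  have S: "S \<in> sets \<mu>" using assms by (simp add: borel_compact)
  have "(\<integral>x. indicator S x *\<^sub>R (x - barycentre \<mu> S) \<partial>\<mu>)
      = (\<integral>x. indicator S x *\<^sub>R x \<partial>\<mu>) - (\<integral>x. indicator S x *\<^sub>R barycentre \<mu> S \<partial>\<mu>)"
    unfolding scaleR_diff_right
    by (intro Bochner_Integration.integral_diff integrable_compact_continuous assms continuous_intros)
  also have "(\<integral>x. indicator S x *\<^sub>R barycentre \<mu> S \<partial>\<mu>) = measure \<mu> S *\<^sub>R barycentre \<mu> S"
    using S sets.sets_into_space[OF S] by (subst integral_scaleR_left) (auto simp: emeasure_eq_measure Int_absorb1)
  also have "\<dots> = (\<integral>x. indicator S x *\<^sub>R x \<partial>\<mu>)"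
    using assms(4) by (simp add: barycentre_def set_lebesgue_integral_def)
  finally show ?thesis by simp
qed

text \<open>A hyperplane strictly separating the barycentre from the hull would make one component of the
  first moment positive.\<close>

lemma barycentre_in_hull:
  fixes \<mu> :: "(real^'n) measure"
  assumes "finite_measure \<mu>" "sets \<mu> = sets borel" "compact S" "0 < measure \<mu> S"
  shows "barycentre \<mu> S \<in> convex hull S"
proof (rule ccontr)
  interpret finite_measure \<mu> by fact
  have S: "S \<in> sets \<mu>" using assms by (simp add: borel_compact)
  define z where "z = barycentre \<mu> S"
  assume "barycentre \<mu> S \<notin> convex hull S"
  then obtain a b where ab: "inner a z < b" "\<And>x. x \<in> convex hull S \<Longrightarrow> b < inner a x"
    using separating_hyperplane_closed_point[of "convex hull S" z]
      compact_imp_closed[OF compact_convex_hull[OF assms(3)]] convex_convex_hull[of S]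
    by (auto simp: z_def)
  have int: "integrable \<mu> (\<lambda>x. indicator S x *\<^sub>R (x - z))"
    by (intro integrable_compact_continuous assms continuous_intros)
  have "(b - inner a z) * measure \<mu> S = (\<integral>x. indicator S x *\<^sub>R (b - inner a z) \<partial>\<mu>)"
    using S sets.sets_into_space[OF S] by (subst integral_scaleR_left) (auto simp: emeasure_eq_measure Int_absorb1)
  also have "\<dots> \<le> (\<integral>x. inner a (indicator S x *\<^sub>R (x - z)) \<partial>\<mu>)"
  proof (rule integral_mono)
    show "integrable \<mu> (\<lambda>x. indicator S x *\<^sub>R (b - inner a z))"
      by (intro integrable_compact_continuous assms continuous_intros)
    show "integrable \<mu> (\<lambda>x. inner a (indicator S x *\<^sub>R (x - z)))"
      by (intro integrable_inner_right int)
    show "indicator S x *\<^sub>R (b - inner a z) \<le> inner a (indicator S x *\<^sub>R (x - z))" for x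
      using ab(2)[of x] hull_inc[of x S] by (auto simp: indicator_def inner_diff_right less_imp_le)
  qed
  also have "\<dots> = inner a (\<integral>x. indicator S x *\<^sub>R (x - z) \<partial>\<mu>)"
    using int by (rule integral_inner_right) 
  also have "\<dots> = 0" using barycentre_moment[OF assms] by (simp add: z_def)
  finally show False using ab(1) assms(4) by (simp add: mult_le_0_iff)
qed

lemma dist_hull_le_diameter:
  fixes S :: "'a::real_normed_vector set"
  assumes "bounded S" "x \<in> S" "y \<in> convex hull S"
  shows "dist x y \<le> diameter S"
proof -
  have "S \<subseteq> cball x (diameter S)" using diameter_bounded_bound[OF assms(1,2)] by auto
  then have "convex hull S \<subseteq> cball x (diameter S)" by (rule hull_minimal) (rule convex_cball)
  then show ?thesis using assms(3) by auto
qed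

section \<open>One-point cubature on a product of two pieces\<close>

lemma finite_measure_pair:
  assumes "finite_measure \<mu>" "finite_measure \<mu>'"
  shows "finite_measure (\<mu> \<Otimes>\<^sub>M \<mu>')"
proof -
  interpret A: finite_measure \<mu> by fact
  interpret B: finite_measure \<mu>' by fact
  have "emeasure (\<mu> \<Otimes>\<^sub>M \<mu>') (space \<mu> \<times> space \<mu>') = emeasure \<mu> (space \<mu>) * emeasure \<mu>' (space \<mu>')"
    by (intro B.emeasure_pair_measure_Times) auto
  also have "\<dots> \<noteq> \<infinity>" by (simp add: ennreal_mult_eq_top_iff)
  finally show ?thesis by (intro finite_measureI) (simp add: space_pair_measure)
qed

lemma sets_pair_borel:
  fixes \<mu> :: "'a::second_countable_topology measure" and \<mu>' :: "'b::second_countable_topology measure"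
  assumes "sets \<mu> = sets borel" "sets \<mu>' = sets borel"
  shows "sets (\<mu> \<Otimes>\<^sub>M \<mu>') = sets borel"
  by (metis assms borel_prod sets_pair_measure_cong)

text \<open>By Fubini, each component reduces to the vanishing first moment in one of the factors.\<close>

lemma barycentre_pair_moment:
  fixes \<mu> :: "(real^'n) measure" and \<mu>' :: "(real^'k) measure"
  assumes \<mu>: "finite_measure \<mu>" "sets \<mu> = sets borel" "compact S" "0 < measure \<mu> S"
    and \<mu>': "finite_measure \<mu>'" "sets \<mu>' = sets borel" "compact S'" "0 < measure \<mu>' S'"
  shows "(\<integral>z. indicator (S \<times> S') z *\<^sub>R (z - (barycentre \<mu> S, barycentre \<mu>' S')) \<partial>(\<mu> \<Otimes>\<^sub>M \<mu>')) = 0"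
proof -
  interpret A: finite_measure \<mu> by fact
  interpret B: finite_measure \<mu>' by fact
  interpret P: pair_sigma_finite \<mu> \<mu>' ..
  let ?P = "\<mu> \<Otimes>\<^sub>M \<mu>'"
  have S: "S \<in> sets \<mu>" "S' \<in> sets \<mu>'" "S \<subseteq> space \<mu>" "S' \<subseteq> space \<mu>'"
    using \<mu> \<mu>' sets_eq_imp_space_eq[OF \<mu>(2)] sets_eq_imp_space_eq[OF \<mu>'(2)] by (simp_all add: borel_compact)
  define b b' where "b = barycentre \<mu> S" and "b' = barycentre \<mu>' S'"
  have int: "integrable ?P (\<lambda>z. indicator (S \<times> S') z *\<^sub>R g z)"
    if "continuous_on (S \<times> S') g" for g :: "_ \<Rightarrow> 'c::{banach, second_countable_topology}"
    using that \<mu>(1,2,3) \<mu>'(1,2,3)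
    by (intro integrable_compact_continuous finite_measure_pair sets_pair_borel compact_Times)
  have ind: "indicator (S \<times> S') (x, y) = (indicator S x * indicator S' y :: real)" for x y
    by (simp add: indicator_def)
  have 1: "(\<integral>z. indicator (S \<times> S') z *\<^sub>R (fst z - b) \<partial>?P) = 0"
  proof -
    have "(\<integral>z. indicator (S \<times> S') z *\<^sub>R (fst z - b) \<partial>?P)
        = (\<integral>x. (\<integral>y. indicator (S \<times> S') (x, y) *\<^sub>R (fst (x, y) - b) \<partial>\<mu>') \<partial>\<mu>)"
      by (intro P.integral_fst'[symmetric] int continuous_intros)
    also have "\<dots> = (\<integral>x. measure \<mu>' S' *\<^sub>R indicator S x *\<^sub>R (x - b) \<partial>\<mu>)"
    proof (intro Bochner_Integration.integral_cong refl)
      fix x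
      have "(\<integral>y. indicator (S \<times> S') (x, y) *\<^sub>R (fst (x, y) - b) \<partial>\<mu>')
          = (\<integral>y. indicator S' y *\<^sub>R indicator S x *\<^sub>R (x - b) \<partial>\<mu>')"
        by (simp add: ind mult.commute)
      also have "\<dots> = measure \<mu>' S' *\<^sub>R indicator S x *\<^sub>R (x - b)"
        using S by (subst integral_scaleR_left) (auto simp: B.emeasure_eq_measure Int_absorb1)
      finally show "(\<integral>y. indicator (S \<times> S') (x, y) *\<^sub>R (fst (x, y) - b) \<partial>\<mu>')
          = measure \<mu>' S' *\<^sub>R indicator S x *\<^sub>R (x - b)" .
    qed
    also have "\<dots> = measure \<mu>' S' *\<^sub>R (\<integral>x. indicator S x *\<^sub>R (x - b) \<partial>\<mu>)"
      by (rule integral_scaleR_right)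
    finally show ?thesis using barycentre_moment[OF \<mu>] by (simp add: b_def)
  qed
  have 2: "(\<integral>z. indicator (S \<times> S') z *\<^sub>R (snd z - b') \<partial>?P) = 0"
  proof -
    have "(\<integral>z. indicator (S \<times> S') z *\<^sub>R (snd z - b') \<partial>?P)
        = (\<integral>x. (\<integral>y. indicator (S \<times> S') (x, y) *\<^sub>R (snd (x, y) - b') \<partial>\<mu>') \<partial>\<mu>)"
      by (intro P.integral_fst'[symmetric] int continuous_intros)
    also have "\<dots> = (\<integral>x. indicator S x *\<^sub>R (\<integral>y. indicator S' y *\<^sub>R (y - b') \<partial>\<mu>') \<partial>\<mu>)"
      by (simp add: ind scaleR_scaleR[symmetric] integral_scaleR_right del: scaleR_scaleR)
    finally show ?thesis using barycentre_moment[OF \<mu>'] by (simp add: b'_def)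
  qed
  let ?V = "\<integral>z. indicator (S \<times> S') z *\<^sub>R (z - (b, b')) \<partial>?P"
  have iV: "integrable ?P (\<lambda>z. indicator (S \<times> S') z *\<^sub>R (z - (b, b')))"
    by (intro int continuous_intros)
  have "fst ?V = 0" "snd ?V = 0"
    using integral_bounded_linear[OF bounded_linear_fst iV] integral_bounded_linear[OF bounded_linear_snd iV] 1 2
    by simp_all
  then show ?thesis by (simp add: b_def b'_def prod_eq_iff)
qed

text \<open>A linear term about the barycentre contributes nothing to the integral, so only the deviation of
  \<open>f\<close> from an affine function that agrees with it at the node counts.\<close>

lemma one_point_cubature_error:
  fixes \<mu> :: "(real^'n) measure" and \<mu>' :: "(real^'k) measure" and f :: "_ \<Rightarrow> complex"
  assumes \<mu>: "finite_measure \<mu>" "sets \<mu> = sets borel" "compact S" "0 < measure \<mu> S"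
    and \<mu>': "finite_measure \<mu>'" "sets \<mu>' = sets borel" "compact S'" "0 < measure \<mu>' S'"
    and f: "continuous_on (S \<times> S') f" and A: "bounded_linear A"
    and B: "\<And>z. z \<in> S \<times> S' \<Longrightarrow>
      cmod (f z - f (barycentre \<mu> S, barycentre \<mu>' S') - A (z - (barycentre \<mu> S, barycentre \<mu>' S'))) \<le> B"
  shows "cmod ((\<integral>z. indicator (S \<times> S') z *\<^sub>R f z \<partial>(\<mu> \<Otimes>\<^sub>M \<mu>'))
      - complex_of_real (measure \<mu> S * measure \<mu>' S') * f (barycentre \<mu> S, barycentre \<mu>' S'))
    \<le> B * (measure \<mu> S * measure \<mu>' S')"
proof -
  let ?P = "\<mu> \<Otimes>\<^sub>M \<mu>'"
  interpret B: finite_measure \<mu>' by fact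
  interpret P: finite_measure ?P using \<mu>(1) \<mu>'(1) by (rule finite_measure_pair)
  define b where "b = (barycentre \<mu> S, barycentre \<mu>' S')"
  define m where "m = measure \<mu> S * measure \<mu>' S'"
  have SS: "S \<times> S' \<in> sets ?P" "S \<times> S' \<subseteq> space ?P"
    using \<mu> \<mu>' sets_eq_imp_space_eq[OF \<mu>(2)] sets_eq_imp_space_eq[OF \<mu>'(2)]
    by (auto simp: borel_compact space_pair_measure)
  have mP: "measure ?P (S \<times> S') = m"
    using \<mu> \<mu>' by (simp add: m_def measure_def B.emeasure_pair_measure_Times borel_compact enn2real_mult)
  have int: "integrable ?P (\<lambda>z. indicator (S \<times> S') z *\<^sub>R g z)"
    if "continuous_on (S \<times> S') g" for g :: "_ \<Rightarrow> 'c::{banach, second_countable_topology}"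
    using that \<mu>(1,2,3) \<mu>'(1,2,3)
    by (intro integrable_compact_continuous finite_measure_pair sets_pair_borel compact_Times)
  have const: "(\<integral>z. indicator (S \<times> S') z *\<^sub>R k \<partial>?P) = m *\<^sub>R k"
    for k :: "'c::{banach, second_countable_topology}"
    using SS mP by (subst integral_scaleR_left) (auto simp: P.emeasure_eq_measure Int_absorb1)
  have contA: "continuous_on (S \<times> S') (\<lambda>z. A (z - b))"
    by (intro bounded_linear.continuous_on[OF A] continuous_intros)
  have "(\<integral>z. indicator (S \<times> S') z *\<^sub>R A (z - b) \<partial>?P) = (\<integral>z. A (indicator (S \<times> S') z *\<^sub>R (z - b)) \<partial>?P)"
    using linear_scale[OF bounded_linear.linear[OF A]] by simp
  also have "\<dots> = A (\<integral>z. indicator (S \<times> S') z *\<^sub>R (z - b) \<partial>?P)"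
    by (intro integral_bounded_linear[OF A] int continuous_intros)
  also have "\<dots> = 0"
    using barycentre_pair_moment[OF \<mu> \<mu>'] linear_0[OF bounded_linear.linear[OF A]] by (simp add: b_def)
  finally have zero: "(\<integral>z. indicator (S \<times> S') z *\<^sub>R A (z - b) \<partial>?P) = 0" .
  have "(\<integral>z. indicator (S \<times> S') z *\<^sub>R (f z - f b - A (z - b)) \<partial>?P)
      = (\<integral>z. indicator (S \<times> S') z *\<^sub>R f z \<partial>?P) - (\<integral>z. indicator (S \<times> S') z *\<^sub>R f b \<partial>?P)
        - (\<integral>z. indicator (S \<times> S') z *\<^sub>R A (z - b) \<partial>?P)"
    unfolding scaleR_diff_right
    by (subst Bochner_Integration.integral_diff Bochner_Integration.integral_diff[OF int int];
        (intro Bochner_Integration.integrable_diff int f contA continuous_intros)?)+ simp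
  then have eq: "(\<integral>z. indicator (S \<times> S') z *\<^sub>R f z \<partial>?P) - complex_of_real m * f b
      = (\<integral>z. indicator (S \<times> S') z *\<^sub>R (f z - f b - A (z - b)) \<partial>?P)"
    unfolding zero const diff_zero by (simp add: scaleR_conv_of_real)
  have "cmod \<dots> \<le> (\<integral>z. indicator (S \<times> S') z *\<^sub>R B \<partial>?P)"
  proof (rule order_trans[OF integral_norm_bound integral_mono])
    show "integrable ?P (\<lambda>z. cmod (indicator (S \<times> S') z *\<^sub>R (f z - f b - A (z - b))))"
      by (intro integrable_norm int continuous_intros f contA)
    show "integrable ?P (\<lambda>z. indicator (S \<times> S') z *\<^sub>R B)" by (intro int continuous_intros)
    show "cmod (indicator (S \<times> S') z *\<^sub>R (f z - f b - A (z - b))) \<le> indicator (S \<times> S') z *\<^sub>R B" for z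
      using B[of z] by (auto simp: indicator_def b_def)
  qed
  then have "cmod ((\<integral>z. indicator (S \<times> S') z *\<^sub>R f z \<partial>?P) - complex_of_real m * f b) \<le> B * m"
    unfolding eq const by (simp add: mult.commute)
  then show ?thesis unfolding b_def m_def .
qed

section \<open>The error of the cubature rule\<close>

text \<open>Lipschitz constants and suprema of derivatives may be infinite; this reduces each error bound to
  the case of a finite constant.\<close>

lemma ennreal_le_mult_if_finite:
  assumes "0 < K" and "\<And>l. 0 \<le> l \<Longrightarrow> X = ennreal l \<Longrightarrow> e \<le> K * l"
  shows "ennreal e \<le> ennreal K * X"
proof (cases X)
  case (real l)
  then have "ennreal e \<le> ennreal (K * l)" using assms(2) by (intro ennreal_leI) auto
  then show ?thesis using real assms(1) by (simp add: ennreal_mult)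
next
  case top
  then show ?thesis using assms(1) by (simp add: ennreal_mult_top)
qed

lemma lip_const_bound:
  assumes "lip_const S g \<le> ennreal l" "0 \<le> l" "x \<in> S" "y \<in> S"
  shows "norm (g x - g y) \<le> l * norm (x - y)"
proof (cases "x = y")
  case False
  have "ennreal (norm (g x - g y) / norm (x - y)) \<le> lip_const S g"
    unfolding lip_const_def using False assms by (intro SUP_upper2[of "(x, y)"]) auto
  then have "norm (g x - g y) / norm (x - y) \<le> l"
    using assms(1,2) by (metis ennreal_le_iff order_trans)
  then show ?thesis using False by (simp add: pos_divide_le_eq)
qed simp

locale cubature_setting =
  A: invariant_measure_attractor M s \<rho> \<Gamma> p \<mu> + B: invariant_measure_attractor M' s' \<rho>' \<Gamma>' p' \<mu>'
  for M :: nat and s :: "nat \<Rightarrow> real^'n \<Rightarrow> real^'n" and \<rho> :: "nat \<Rightarrow> real" and \<Gamma> :: "(real^'n) set"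
    and p :: "nat \<Rightarrow> real" and \<mu> :: "(real^'n) measure"
    and M' :: nat and s' :: "nat \<Rightarrow> real^'k \<Rightarrow> real^'k" and \<rho>' :: "nat \<Rightarrow> real" and \<Gamma>' :: "(real^'k) set"
    and p' :: "nat \<Rightarrow> real" and \<mu>' :: "(real^'k) measure" +
  fixes h :: real and f :: "(real^'n) \<times> (real^'k) \<Rightarrow> complex"
  assumes h_pos: "0 < h" and f_cont: "continuous_on (\<Gamma> \<times> \<Gamma>') f"
begin

abbreviation L :: "nat list set" where "L \<equiv> ifs_indices M s \<Gamma> h"
abbreviation L' :: "nat list set" where "L' \<equiv> ifs_indices M' s' \<Gamma>' h"

abbreviation node :: "nat list \<Rightarrow> nat list \<Rightarrow> (real^'n) \<times> (real^'k)" where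
  "node w w' \<equiv> (barycentre \<mu> (A.piece w), barycentre \<mu>' (B.piece w'))"

abbreviation hulls :: "nat list \<times> nat list \<Rightarrow> ((real^'n) \<times> (real^'k)) set" where
  "hulls \<equiv> (\<lambda>(w, w'). (convex hull (A.piece w)) \<times> (convex hull (B.piece w')))"

abbreviation hull_region :: "((real^'n) \<times> (real^'k)) set" where
  "hull_region \<equiv> hull_union M s \<Gamma> h \<times> hull_union M' s' \<Gamma>' h"

abbreviation mass :: real where "mass \<equiv> measure \<mu> \<Gamma> * measure \<mu>' \<Gamma>'"

abbreviation cubature_error :: real where
  "cubature_error \<equiv> cmod (double_integral \<Gamma> \<mu> \<Gamma>' \<mu>' f - cubature M s \<Gamma> \<mu> M' s' \<Gamma>' \<mu>' h f)"

lemma mass_pos: "0 < mass"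
  using A.measure_attractor_pos B.measure_attractor_pos by simp

lemma double_integral_eq_sum:
  "double_integral \<Gamma> \<mu> \<Gamma>' \<mu>' f =
    (\<Sum>w\<in>L. \<Sum>w'\<in>L'. \<integral>z. indicator (A.piece w \<times> B.piece w') z *\<^sub>R f z \<partial>(\<mu> \<Otimes>\<^sub>M \<mu>'))"
proof -
  let ?P = "\<mu> \<Otimes>\<^sub>M \<mu>'"
  interpret P: pair_sigma_finite \<mu> \<mu>' ..
  note [measurable] = A.piece_borel B.piece_borel
  have P: "finite_measure ?P" "sets ?P = sets borel"
    by (rule finite_measure_pair[OF A.finite_measure B.finite_measure])
       (rule sets_pair_borel[OF A.sets_eq B.sets_eq])
  have int: "integrable ?P (\<lambda>z. indicator (S \<times> S') z *\<^sub>R f z)"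
    if "compact S" "compact S'" "S \<subseteq> \<Gamma>" "S' \<subseteq> \<Gamma>'" for S S'
    using that by (intro integrable_compact_continuous P compact_Times continuous_on_subset[OF f_cont]) auto
  have int_pieces: "integrable ?P (\<lambda>z. indicator (A.piece w \<times> B.piece w') z *\<^sub>R f z)"
    if "w \<in> L" "w' \<in> L'" for w w'
    using that h_pos A.indices_words B.indices_words
    by (intro int A.compact_piece B.compact_piece A.piece_subset_attractor B.piece_subset_attractor)
  have int_whole: "integrable ?P (\<lambda>z. indicator (\<Gamma> \<times> \<Gamma>') z *\<^sub>R f z)"
    by (intro int A.compact_attractor B.compact_attractor order.refl)
  have ind: "indicator (S \<times> S') (x, y) = (indicator S x * indicator S' y :: real)"
    for S :: "(real^'n) set" and S' :: "(real^'k) set" and x y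
    by (simp add: indicator_def)
  let ?I = "\<lambda>z. \<Sum>w\<in>L. \<Sum>w'\<in>L'. indicator (A.piece w \<times> B.piece w') z :: real"
  have meas: "?I \<in> borel_measurable ?P" "(indicator (\<Gamma> \<times> \<Gamma>') :: _ \<Rightarrow> real) \<in> borel_measurable ?P"
    using A.indices_words[OF h_pos] B.indices_words[OF h_pos] A.compact_piece B.compact_piece
      A.compact_attractor B.compact_attractor
    by (auto simp: measurable_cong_sets[OF P(2) refl] intro!: borel_measurable_sum
        borel_measurable_indicator borel_compact compact_Times)
  have "AE z in ?P. indicator (\<Gamma> \<times> \<Gamma>') z = ?I z"
  proof (rule P.AE_pair_measure)
    show "{z \<in> space ?P. indicator (\<Gamma> \<times> \<Gamma>') z = ?I z} \<in> sets ?P"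
      using meas by measurable
    show "AE x in \<mu>. AE y in \<mu>'. indicator (\<Gamma> \<times> \<Gamma>') (x, y) = ?I (x, y)"
      using A.AE_indicator_attractor_eq_sum[OF h_pos]
    proof eventually_elim
      case (elim x)
      show ?case
        using B.AE_indicator_attractor_eq_sum[OF h_pos]
        by eventually_elim (simp add: ind elim sum_product)
    qed
  qed
  then have AE: "AE z in ?P. indicator (\<Gamma> \<times> \<Gamma>') z *\<^sub>R f z
      = (\<Sum>w\<in>L. \<Sum>w'\<in>L'. indicator (A.piece w \<times> B.piece w') z *\<^sub>R f z)"
    by eventually_elim (simp add: scaleR_sum_left)
  have "double_integral \<Gamma> \<mu> \<Gamma>' \<mu>' f = (\<integral>x. (\<integral>y. indicator (\<Gamma> \<times> \<Gamma>') (x, y) *\<^sub>R f (x, y) \<partial>\<mu>') \<partial>\<mu>)"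
    unfolding double_integral_def set_lebesgue_integral_def ind scaleR_scaleR[symmetric] integral_scaleR_right ..
  also have "\<dots> = (\<integral>z. indicator (\<Gamma> \<times> \<Gamma>') z *\<^sub>R f z \<partial>?P)"
    by (rule P.integral_fst'[OF int_whole])
  also have "\<dots> = (\<integral>z. (\<Sum>w\<in>L. \<Sum>w'\<in>L'. indicator (A.piece w \<times> B.piece w') z *\<^sub>R f z) \<partial>?P)"
    using AE int_whole int_pieces
    by (intro integral_cong_AE borel_measurable_integrable Bochner_Integration.integrable_sum) auto
  also have "\<dots> = (\<Sum>w\<in>L. \<Sum>w'\<in>L'. \<integral>z. indicator (A.piece w \<times> B.piece w') z *\<^sub>R f z \<partial>?P)"
    using int_pieces
    by (subst Bochner_Integration.integral_sum; (intro Bochner_Integration.integrable_sum sum.cong refl)?)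
       (auto intro!: Bochner_Integration.integral_sum)
  finally show ?thesis .
qed

lemma cubature_error_le:
  assumes lin: "\<And>w w'. w \<in> L \<Longrightarrow> w' \<in> L' \<Longrightarrow> bounded_linear (T w w')"
    and bound: "\<And>w w' z. w \<in> L \<Longrightarrow> w' \<in> L' \<Longrightarrow> z \<in> A.piece w \<times> B.piece w' \<Longrightarrow>
      cmod (f z - f (node w w') - T w w' (z - node w w')) \<le> C"
  shows "cubature_error \<le> C * mass"
proof -
  let ?m = "\<lambda>w w'. measure \<mu> (A.piece w) * measure \<mu>' (B.piece w')"
  let ?D = "\<lambda>w w'. (\<integral>z. indicator (A.piece w \<times> B.piece w') z *\<^sub>R f z \<partial>(\<mu> \<Otimes>\<^sub>M \<mu>'))
      - complex_of_real (?m w w') * f (node w w')"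
  have D: "cmod (?D w w') \<le> C * ?m w w'" if w: "w \<in> L" "w' \<in> L'" for w w'
  proof -
    have W: "w \<in> A.words" "w' \<in> B.words"
      using w A.indices_words[OF h_pos] B.indices_words[OF h_pos] by auto
    have "continuous_on (A.piece w \<times> B.piece w') f"
      using A.piece_subset_attractor[OF W(1)] B.piece_subset_attractor[OF W(2)]
      by (intro continuous_on_subset[OF f_cont]) auto
    then show ?thesis
      using W lin[OF w] bound[OF w]
      by (intro one_point_cubature_error A.finite_measure B.finite_measure A.sets_eq B.sets_eq
          A.compact_piece B.compact_piece A.measure_piece_pos B.measure_piece_pos)
  qed
  have "cubature_error = cmod (\<Sum>w\<in>L. \<Sum>w'\<in>L'. ?D w w')"
    by (simp add: double_integral_eq_sum cubature_def sum_subtractf)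
  also have "\<dots> \<le> (\<Sum>w\<in>L. \<Sum>w'\<in>L'. C * ?m w w')"
    by (intro order_trans[OF norm_sum] sum_mono D)
  also have "\<dots> = C * ((\<Sum>w\<in>L. measure \<mu> (A.piece w)) * (\<Sum>w'\<in>L'. measure \<mu>' (B.piece w')))"
    by (subst sum_product) (simp only: sum_distrib_left)
  also have "\<dots> = C * mass"
    using A.sum_measure_indices[OF h_pos] B.sum_measure_indices[OF h_pos] by simp
  finally show ?thesis .
qed

lemma node_in_hulls:
  assumes "w \<in> L" "w' \<in> L'"
  shows "node w w' \<in> hulls (w, w')"
proof -
  have W: "w \<in> A.words" "w' \<in> B.words"
    using assms A.indices_words[OF h_pos] B.indices_words[OF h_pos] by auto
  have "barycentre \<mu> (A.piece w) \<in> convex hull A.piece w"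
    by (rule barycentre_in_hull[OF A.finite_measure A.sets_eq A.compact_piece[OF W(1)] A.measure_piece_pos[OF W(1)]])
  moreover have "barycentre \<mu>' (B.piece w') \<in> convex hull B.piece w'"
    by (rule barycentre_in_hull[OF B.finite_measure B.sets_eq B.compact_piece[OF W(2)] B.measure_piece_pos[OF W(2)]])
  ultimately show ?thesis by simp
qed

lemma pieces_subset_hulls: "A.piece w \<times> B.piece w' \<subseteq> hulls (w, w')"
  using hull_subset[of "A.piece w" convex] hull_subset[of "B.piece w'" convex] by auto

lemma convex_hulls: "convex (hulls q)"
  by (auto simp: split_beta intro!: convex_Times convex_convex_hull)

lemma hulls_subset_region: "w \<in> L \<Longrightarrow> w' \<in> L' \<Longrightarrow> hulls (w, w') \<subseteq> hull_region"
  by (auto simp: hull_union_def)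

lemma norm_node_le:
  assumes w: "w \<in> L" "w' \<in> L'" and z: "z \<in> A.piece w \<times> B.piece w'"
  shows "norm (z - node w w') \<le> sqrt 2 * h"
proof -
  obtain x y where xy: "z = (x, y)" "x \<in> A.piece w" "y \<in> B.piece w'" using z by auto
  have W: "w \<in> A.words" "w' \<in> B.words"
    using w A.indices_words[OF h_pos] B.indices_words[OF h_pos] by auto
  have "dist x (fst (node w w')) \<le> h"
    using dist_hull_le_diameter[OF compact_imp_bounded[OF A.compact_piece[OF W(1)]] xy(2)]
      node_in_hulls[OF w] A.indices_diameter[OF h_pos w(1)] by (auto intro: order_trans)
  moreover have "dist y (snd (node w w')) \<le> h"
    using dist_hull_le_diameter[OF compact_imp_bounded[OF B.compact_piece[OF W(2)]] xy(3)]
      node_in_hulls[OF w] B.indices_diameter[OF h_pos w(2)] by (auto intro: order_trans)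
  ultimately have "(dist x (fst (node w w')))\<^sup>2 + (dist y (snd (node w w')))\<^sup>2 \<le> h\<^sup>2 + h\<^sup>2"
    by (intro add_mono power_mono) auto
  then have "norm (z - node w w') \<le> sqrt (2 * h\<^sup>2)"
    by (simp add: xy(1) norm_prod_def dist_norm)
  then show ?thesis using h_pos by (simp add: real_sqrt_mult)
qed

lemma norm_node_square_le:
  assumes "w \<in> L" "w' \<in> L'" "z \<in> A.piece w \<times> B.piece w'"
  shows "(norm (z - node w w'))\<^sup>2 \<le> 2 * h\<^sup>2"
  using power_mono[OF norm_node_le[OF assms] norm_ge_zero, of 2] by (simp add: power_mult_distrib)

lemma lip_const_hulls_bound:
  assumes "(MAX q\<in>L \<times> L'. lip_const (hulls q) g) = ennreal l" "0 \<le> l"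
    and w: "w \<in> L" "w' \<in> L'" and xy: "x \<in> hulls (w, w')" "y \<in> hulls (w, w')"
  shows "norm (g x - g y) \<le> l * norm (x - y)"
proof (rule lip_const_bound[OF _ assms(2) xy])
  have "lip_const (hulls (w, w')) g \<le> (MAX q\<in>L \<times> L'. lip_const (hulls q) g)"
    using w A.finite_indices[OF h_pos] B.finite_indices[OF h_pos]
    by (intro Max_ge) (auto intro!: image_eqI[of _ _ "(w, w')"])
  then show "lip_const (hulls (w, w')) g \<le> ennreal l" using assms(1) by simp
qed

lemma SUP_region_bound:
  assumes "(SUP z\<in>hull_region. ennreal (g z)) = ennreal l" "0 \<le> l" "w \<in> L" "w' \<in> L'" "z \<in> hulls (w, w')"
  shows "g z \<le> l"
proof -
  have "ennreal (g z) \<le> ennreal l"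
    unfolding assms(1)[symmetric] using hulls_subset_region[OF assms(3,4)] assms(5)
    by (intro SUP_upper) blast
  then show ?thesis using assms(2) by simp
qed

lemma error_lipschitz:
  "ennreal cubature_error \<le> ennreal (sqrt 2 * h * mass) * (MAX q\<in>L \<times> L'. lip_const (hulls q) f)"
proof (rule ennreal_le_mult_if_finite)
  fix l :: real assume l: "0 \<le> l" "(MAX q\<in>L \<times> L'. lip_const (hulls q) f) = ennreal l"
  have "cubature_error \<le> (l * (sqrt 2 * h)) * mass"
  proof (rule cubature_error_le[where T = "\<lambda>w w' z. 0"])
    fix w w' z assume w: "w \<in> L" "w' \<in> L'" "z \<in> A.piece w \<times> B.piece w'"
    have "cmod (f z - f (node w w')) \<le> l * norm (z - node w w')"
      using lip_const_hulls_bound[OF l(2,1) w(1,2)] node_in_hulls[OF w(1,2)] pieces_subset_hulls w(3) by blast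
    also have "\<dots> \<le> l * (sqrt 2 * h)" using norm_node_le[OF w] l(1) by (intro mult_left_mono)
    finally show "cmod (f z - f (node w w') - 0) \<le> l * (sqrt 2 * h)" by simp
  qed simp
  then show "cubature_error \<le> sqrt 2 * h * mass * l" by (simp add: mult_ac)
qed (use h_pos mass_pos in auto)

lemma error_gradient:
  assumes \<Omega>: "open \<Omega>" "hull_region \<subseteq> \<Omega>" "f differentiable_on \<Omega>"
  shows "ennreal cubature_error
    \<le> ennreal (sqrt 2 * h * mass) * (SUP z\<in>hull_region. ennreal (norm (gradient f z)))"
proof (rule ennreal_le_mult_if_finite)
  fix l :: real assume l: "0 \<le> l" "(SUP z\<in>hull_region. ennreal (norm (gradient f z))) = ennreal l"
  have "cubature_error \<le> (l * (sqrt 2 * h)) * mass"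
  proof (rule cubature_error_le[where T = "\<lambda>w w' z. 0"])
    fix w w' z assume w: "w \<in> L" "w' \<in> L'" "z \<in> A.piece w \<times> B.piece w'"
    have df: "f differentiable (at x)" if "x \<in> hulls (w, w')" for x
      using that hulls_subset_region[OF w(1,2)] \<Omega> differentiable_on_eq_differentiable_at[OF \<Omega>(1)] by blast
    have "cmod (f z - f (node w w')) \<le> l * norm (z - node w w')"
      using pieces_subset_hulls w(3) SUP_region_bound[OF l(2,1) w(1,2)]
      by (intro mean_value_gradient_bound[OF convex_hulls node_in_hulls[OF w(1,2)] _ df]) auto
    also have "\<dots> \<le> l * (sqrt 2 * h)" using norm_node_le[OF w] l(1) by (intro mult_left_mono)
    finally show "cmod (f z - f (node w w') - 0) \<le> l * (sqrt 2 * h)" by simp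
  qed simp
  then show "cubature_error \<le> sqrt 2 * h * mass * l" by (simp add: mult_ac)
qed (use h_pos mass_pos in auto)

text \<open>With the tangent at each node as the linear term, a gradient that is \<open>l\<close>-Lipschitz from the nodes
  gives the second-order bound.\<close>

lemma error_of_gradient_lipschitz:
  assumes \<Omega>: "open \<Omega>" "hull_region \<subseteq> \<Omega>" "f differentiable_on \<Omega>" and "0 \<le> l"
    and lip: "\<And>w w' x. w \<in> L \<Longrightarrow> w' \<in> L' \<Longrightarrow> x \<in> hulls (w, w') \<Longrightarrow>
      norm (gradient f x - gradient f (node w w')) \<le> l * norm (x - node w w')"
  shows "cubature_error \<le> h\<^sup>2 * mass * l"
proof -
  have "cubature_error \<le> (l * h\<^sup>2) * mass"
  proof (rule cubature_error_le[where T = "\<lambda>w w'. linear_form (gradient f (node w w'))"])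
    fix w w' z assume w: "w \<in> L" "w' \<in> L'" "z \<in> A.piece w \<times> B.piece w'"
    have df: "f differentiable (at x)" if "x \<in> hulls (w, w')" for x
      using that hulls_subset_region[OF w(1,2)] \<Omega> differentiable_on_eq_differentiable_at[OF \<Omega>(1)] by blast
    have "cmod (f z - f (node w w') - linear_form (gradient f (node w w')) (z - node w w'))
        \<le> l / 2 * (norm (z - node w w'))\<^sup>2"
      using pieces_subset_hulls w(3) lip[OF w(1,2)]
      by (intro taylor_remainder_lipschitz_gradient[OF convex_hulls node_in_hulls[OF w(1,2)] _ df]) auto
    also have "\<dots> \<le> l / 2 * (2 * h\<^sup>2)"
      using norm_node_square_le[OF w] assms(4) by (intro mult_left_mono) auto
    finally show "cmod (f z - f (node w w') - linear_form (gradient f (node w w')) (z - node w w')) \<le> l * h\<^sup>2"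
      by simp
  qed (rule bounded_linear_linear_form)
  then show ?thesis by (simp add: mult_ac)
qed

lemma error_gradient_lipschitz:
  assumes \<Omega>: "open \<Omega>" "hull_region \<subseteq> \<Omega>" "f differentiable_on \<Omega>"
  shows "ennreal cubature_error
    \<le> ennreal (2 * h\<^sup>2 * mass) * (MAX q\<in>L \<times> L'. lip_const (hulls q) (gradient f))"
proof (rule ennreal_le_mult_if_finite)
  fix l :: real assume l: "0 \<le> l" "(MAX q\<in>L \<times> L'. lip_const (hulls q) (gradient f)) = ennreal l"
  have "cubature_error \<le> h\<^sup>2 * mass * l"
    using lip_const_hulls_bound[OF l(2,1)] node_in_hulls
    by (intro error_of_gradient_lipschitz[OF \<Omega> l(1)]) blast
  also have "\<dots> \<le> 2 * h\<^sup>2 * mass * l"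
    using l(1) mass_pos by simp
  finally show "cubature_error \<le> 2 * h\<^sup>2 * mass * l" .
qed (use h_pos mass_pos in auto)

lemma error_hessian:
  assumes \<Omega>: "open \<Omega>" "hull_region \<subseteq> \<Omega>" "twice_differentiable_on f \<Omega>"
  shows "ennreal cubature_error
    \<le> ennreal (h\<^sup>2 * mass) * (SUP z\<in>hull_region. ennreal (matrix_norm2 (hessian f z)))"
proof (rule ennreal_le_mult_if_finite)
  fix l :: real assume l: "0 \<le> l" "(SUP z\<in>hull_region. ennreal (matrix_norm2 (hessian f z))) = ennreal l"
  have df: "f differentiable_on \<Omega>" using \<Omega>(3) by (simp add: twice_differentiable_on_def)
  show "cubature_error \<le> h\<^sup>2 * mass * l"
  proof (rule error_of_gradient_lipschitz[OF \<Omega>(1,2) df l(1)])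
    fix w w' x assume w: "w \<in> L" "w' \<in> L'" "x \<in> hulls (w, w')"
    have "hulls (w, w') \<subseteq> \<Omega>" using hulls_subset_region[OF w(1,2)] \<Omega>(2) by (rule order_trans)
    then show "norm (gradient f x - gradient f (node w w')) \<le> l * norm (x - node w w')"
      using SUP_region_bound[OF l(2,1) w(1,2)]
      by (intro gradient_lipschitz_hessian[OF \<Omega>(1) _ \<Omega>(3) convex_hulls node_in_hulls[OF w(1,2)] w(3)])
  qed
qed (use h_pos mass_pos in auto)

end

lemma ennreal_mult_SUP_le:
  assumes "0 \<le> K" "0 \<le> C" "\<And>z. z \<in> D \<Longrightarrow> g z \<le> ennreal C * G z"
  shows "ennreal K * (SUP z\<in>D. g z) \<le> ennreal (C * K) * (SUP z\<in>D. G z)"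
proof -
  have "(SUP z\<in>D. g z) \<le> ennreal C * (SUP z\<in>D. G z)"
    by (intro SUP_least order_trans[OF assms(3)] mult_left_mono SUP_upper) auto
  then have "ennreal K * (SUP z\<in>D. g z) \<le> ennreal K * (ennreal C * (SUP z\<in>D. G z))"
    by (rule mult_left_mono) simp
  then show ?thesis using assms(1,2) by (simp add: ennreal_mult mult_ac)
qed

lemma gradient_le_partial_derivatives:
  fixes f :: "(real^'n) \<times> (real^'k) \<Rightarrow> complex"
  shows "ennreal (norm (gradient f z)) \<le> ennreal (sqrt (real (CARD('n) + CARD('k)))) *
    (MAX \<alpha>\<in>multi_indices 1. ennreal (cmod (multi_deriv \<alpha> f z)))"
proof -
  define m where "m = (MAX c. cmod (gradient f z $ c))"
  have le: "cmod (gradient f z $ c) \<le> m" for c unfolding m_def by (intro Max_ge) auto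
  have "m \<in> range (\<lambda>c. cmod (gradient f z $ c))" unfolding m_def by (intro Max_in) auto
  then obtain c where c: "m = cmod (partial_deriv c f z)" by (auto simp: gradient_def)
  obtain \<alpha> where "\<alpha> \<in> multi_indices 1" "multi_deriv \<alpha> f = partial_deriv c f"
    using multi_deriv_order_1 by blast
  then have "ennreal m \<le> (MAX \<alpha>\<in>multi_indices 1. ennreal (cmod (multi_deriv \<alpha> f z)))"
    using c finite_multi_indices by (intro Max_ge) (auto intro!: image_eqI[of _ _ \<alpha>])
  moreover have "ennreal (norm (gradient f z)) \<le> ennreal (sqrt (real (CARD('n) + CARD('k)))) * ennreal m"
    using norm_vec_le_max[OF le] c by (simp add: ennreal_mult[symmetric] ennreal_leI)
  ultimately show ?thesis by (meson mult_left_mono order_trans zero_le)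
qed

lemma hessian_le_partial_derivatives:
  fixes f :: "(real^'n) \<times> (real^'k) \<Rightarrow> complex"
  assumes "open \<Omega>" "z \<in> \<Omega>" "twice_differentiable_on f \<Omega>"
  shows "ennreal (matrix_norm2 (hessian f z)) \<le> ennreal (real (CARD('n) + CARD('k))) *
    (MAX \<alpha>\<in>multi_indices 2. ennreal (cmod (multi_deriv \<alpha> f z)))"
proof -
  let ?e = "\<lambda>(c, d). cmod (hessian f z $ c $ d)"
  define m where "m = (MAX q. ?e q)"
  have "?e (c, d) \<le> m" for c d unfolding m_def by (intro Max_ge) (auto intro!: finite_imageI)
  then have le: "cmod (hessian f z $ c $ d) \<le> m" for c d by simp
  have "m \<in> range ?e" unfolding m_def by (intro Max_in) (auto intro!: finite_imageI)
  then obtain c d where c: "m = cmod (hessian f z $ c $ d)" by auto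
  obtain \<alpha> where \<alpha>: "\<alpha> \<in> multi_indices 2" "multi_deriv \<alpha> f = partial_deriv c (partial_deriv d f) \<or>
     multi_deriv \<alpha> f = partial_deriv d (partial_deriv c f)"
    using multi_deriv_order_2 by blast
  then have "m = cmod (multi_deriv \<alpha> f z)"
    using c hessian_symmetric[OF assms, of c d] by (auto simp: hessian_def)
  then have "ennreal m \<le> (MAX \<alpha>\<in>multi_indices 2. ennreal (cmod (multi_deriv \<alpha> f z)))"
    using \<alpha>(1) finite_multi_indices by (intro Max_ge) auto
  moreover have "ennreal (matrix_norm2 (hessian f z)) \<le> ennreal (real (CARD('n) + CARD('k))) * ennreal m"
  proof -
    have "ennreal (matrix_norm2 (hessian f z)) \<le> ennreal (real (CARD('n) + CARD('k)) * m)"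
      using matrix_norm2_le_max[OF le] by (intro ennreal_leI) simp
    also have "\<dots> = ennreal (real (CARD('n) + CARD('k))) * ennreal m"
      by (rule ennreal_mult) (simp_all add: c)
    finally show ?thesis .
  qed
  ultimately show ?thesis by (meson mult_left_mono order_trans zero_le)
qed

lemma similarity_attractor_exists:
  assumes "similarity_ifs M s" "ifs_attractor M s \<Gamma>"
  shows "\<exists>\<rho>. similarity_attractor M s \<rho> \<Gamma>"
proof -
  have "\<forall>m\<in>{1..M}. \<exists>\<rho>. 0 < \<rho> \<and> \<rho> < 1 \<and> (\<forall>x y. dist (s m x) (s m y) = \<rho> * dist x y) \<and> surj (s m)"
  proof
    fix m assume "m \<in> {1..M}"
    then obtain \<rho> A \<delta> where *: "0 < \<rho>" "\<rho> < 1" "orthogonal_matrix A" "s m = (\<lambda>x. \<rho> *\<^sub>R (A *v x) + \<delta>)"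
      using assms(1) unfolding similarity_ifs_def by blast
    have "orthogonal_transformation (\<lambda>x. A *v x)"
      using *(3) by (simp add: orthogonal_transformation_matrix)
    then have norm: "norm (A *v x) = norm x" and surj: "surj (\<lambda>x. A *v x)" for x
      using orthogonal_transformation_norm orthogonal_transformation_surj by blast+
    have "dist (s m x) (s m y) = \<rho> * dist x y" for x y
    proof -
      have "s m x - s m y = \<rho> *\<^sub>R (A *v (x - y))"
        by (simp add: *(4) matrix_vector_mult_diff_distrib scaleR_diff_right)
      then show ?thesis using *(1) by (simp add: dist_norm norm)
    qed
    moreover have "surj (s m)"
      unfolding surj_def
    proof
      fix y
      obtain x where "A *v x = (1 / \<rho>) *\<^sub>R (y - \<delta>)" using surj by (metis surjD)
      then show "\<exists>x. y = s m x" using *(1) by (intro exI[of _ x]) (simp add: *(4))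
    qed
    ultimately show "\<exists>\<rho>. 0 < \<rho> \<and> \<rho> < 1 \<and> (\<forall>x y. dist (s m x) (s m y) = \<rho> * dist x y) \<and> surj (s m)"
      using *(1,2) by blast
  qed
  then obtain \<rho> where "\<forall>m\<in>{1..M}. 0 < \<rho> m \<and> \<rho> m < 1 \<and>
      (\<forall>x y. dist (s m x) (s m y) = \<rho> m * dist x y) \<and> surj (s m)"
    by (metis bchoice)
  then show ?thesis using assms(2) by (intro exI[of _ \<rho>]) (unfold_locales, auto)
qed

theorem theorem3p7:
  fixes s :: "nat \<Rightarrow> real^'n \<Rightarrow> real^'n" and s' :: "nat \<Rightarrow> real^'k \<Rightarrow> real^'k"
    and M M' :: nat and p p' :: "nat \<Rightarrow> real"
    and \<Gamma> :: "(real^'n) set" and \<Gamma>' :: "(real^'k) set"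
    and \<mu> :: "(real^'n) measure" and \<mu>' :: "(real^'k) measure"
    and h :: real and f :: "(real^'n) \<times> (real^'k) \<Rightarrow> complex"
  defines "L \<equiv> ifs_indices M s \<Gamma> h" and "L' \<equiv> ifs_indices M' s' \<Gamma>' h"
    and "D \<equiv> hull_union M s \<Gamma> h \<times> hull_union M' s' \<Gamma>' h"
    and "K \<equiv> (\<lambda>(w, w'). (convex hull (ifs_piece s \<Gamma> w)) \<times> (convex hull (ifs_piece s' \<Gamma>' w')))"
    and "c \<equiv> measure \<mu> \<Gamma> * measure \<mu>' \<Gamma>'"
    and "E \<equiv> cmod (double_integral \<Gamma> \<mu> \<Gamma>' \<mu>' f - cubature M s \<Gamma> \<mu> M' s' \<Gamma>' \<mu>' h f)"
  assumes "similarity_ifs M s" and "open_set_condition M s" and "ifs_attractor M s \<Gamma>"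
    and "similarity_ifs M' s'" and "open_set_condition M' s'" and "ifs_attractor M' s' \<Gamma>'"
    and "\<forall>m\<in>{1..M}. 0 < p m \<and> p m < 1" and "(\<Sum>m\<in>{1..M}. p m) = 1"
    and "\<forall>m\<in>{1..M'}. 0 < p' m \<and> p' m < 1" and "(\<Sum>m\<in>{1..M'}. p' m) = 1"
    and "invariant_measure M s p \<Gamma> \<mu>" and "invariant_measure M' s' p' \<Gamma>' \<mu>'"
    and "h > 0" and "continuous_on (\<Gamma> \<times> \<Gamma>') f"
  shows
    "ennreal E \<le> ennreal (sqrt 2 * h * c) * (MAX q\<in>L \<times> L'. lip_const (K q) f)
     \<and>
     (\<forall>\<Omega>. open \<Omega> \<and> D \<subseteq> \<Omega> \<and> f differentiable_on \<Omega> \<longrightarrow>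
       ennreal E \<le> ennreal (sqrt 2 * h * c) * (SUP z\<in>D. ennreal (norm (gradient f z))) \<and>
       ennreal (sqrt 2 * h * c) * (SUP z\<in>D. ennreal (norm (gradient f z)))
         \<le> ennreal (sqrt 2 * sqrt (real (CARD('n) + CARD('k))) * h * c) *
             (SUP z\<in>D. MAX \<alpha>\<in>multi_indices 1. ennreal (cmod (multi_deriv \<alpha> f z))) \<and>
       ennreal E \<le> ennreal (2 * h\<^sup>2 * c) * (MAX q\<in>L \<times> L'. lip_const (K q) (gradient f)))
     \<and>
     (\<forall>\<Omega>. open \<Omega> \<and> D \<subseteq> \<Omega> \<and> twice_differentiable_on f \<Omega> \<longrightarrow>
       ennreal E \<le> ennreal (h\<^sup>2 * c) * (SUP z\<in>D. ennreal (matrix_norm2 (hessian f z))) \<and>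
       ennreal (h\<^sup>2 * c) * (SUP z\<in>D. ennreal (matrix_norm2 (hessian f z)))
         \<le> ennreal (real (CARD('n) + CARD('k)) * h\<^sup>2 * c) *
             (SUP z\<in>D. MAX \<alpha>\<in>multi_indices 2. ennreal (cmod (multi_deriv \<alpha> f z))))"
proof -
  obtain \<rho> where "similarity_attractor M s \<rho> \<Gamma>"
    using similarity_attractor_exists assms by blast
  then interpret A: similarity_attractor M s \<rho> \<Gamma> .
  obtain \<rho>' where "similarity_attractor M' s' \<rho>' \<Gamma>'"
    using similarity_attractor_exists assms by blast
  then interpret B: similarity_attractor M' s' \<rho>' \<Gamma>' .
  interpret C: cubature_setting M s \<rho> \<Gamma> p \<mu> M' s' \<rho>' \<Gamma>' p' \<mu>' h f
    by unfold_locales (use assms in auto)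
  have pos: "0 \<le> sqrt 2 * h * c" "0 \<le> h\<^sup>2 * c"
    using C.mass_pos C.h_pos unfolding c_def by simp_all
  show ?thesis
  proof (intro conjI allI impI; (elim conjE)?)
    show "ennreal E \<le> ennreal (sqrt 2 * h * c) * (MAX q\<in>L \<times> L'. lip_const (K q) f)"
      unfolding E_def c_def L_def L'_def K_def by (rule C.error_lipschitz)
  next
    fix \<Omega> assume \<Omega>: "open \<Omega>" "D \<subseteq> \<Omega>" "f differentiable_on \<Omega>"
    show "ennreal E \<le> ennreal (sqrt 2 * h * c) * (SUP z\<in>D. ennreal (norm (gradient f z)))"
      unfolding E_def c_def D_def by (rule C.error_gradient[OF \<Omega>(1) \<Omega>(2)[unfolded D_def] \<Omega>(3)])
    show "ennreal E \<le> ennreal (2 * h\<^sup>2 * c) * (MAX q\<in>L \<times> L'. lip_const (K q) (gradient f))"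
      unfolding E_def c_def L_def L'_def K_def
      by (rule C.error_gradient_lipschitz[OF \<Omega>(1) \<Omega>(2)[unfolded D_def] \<Omega>(3)])
    have eq: "sqrt 2 * sqrt (real (CARD('n) + CARD('k))) * h * c = sqrt (real (CARD('n) + CARD('k))) * (sqrt 2 * h * c)"
      by simp
    show "ennreal (sqrt 2 * h * c) * (SUP z\<in>D. ennreal (norm (gradient f z)))
         \<le> ennreal (sqrt 2 * sqrt (real (CARD('n) + CARD('k))) * h * c) *
             (SUP z\<in>D. MAX \<alpha>\<in>multi_indices 1. ennreal (cmod (multi_deriv \<alpha> f z)))"
      unfolding eq by (intro ennreal_mult_SUP_le[OF pos(1)] gradient_le_partial_derivatives) simp
  next
    fix \<Omega> assume \<Omega>: "open \<Omega>" "D \<subseteq> \<Omega>" "twice_differentiable_on f \<Omega>"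
    show "ennreal E \<le> ennreal (h\<^sup>2 * c) * (SUP z\<in>D. ennreal (matrix_norm2 (hessian f z)))"
      unfolding E_def c_def D_def by (rule C.error_hessian[OF \<Omega>(1) \<Omega>(2)[unfolded D_def] \<Omega>(3)])
    have *: "ennreal (matrix_norm2 (hessian f z)) \<le> ennreal (real (CARD('n) + CARD('k))) *
        (MAX \<alpha>\<in>multi_indices 2. ennreal (cmod (multi_deriv \<alpha> f z)))" if "z \<in> D" for z
      using hessian_le_partial_derivatives[OF \<Omega>(1) _ \<Omega>(3)] \<Omega>(2) that by blast
    show "ennreal (h\<^sup>2 * c) * (SUP z\<in>D. ennreal (matrix_norm2 (hessian f z)))
         \<le> ennreal (real (CARD('n) + CARD('k)) * h\<^sup>2 * c) *
             (SUP z\<in>D. MAX \<alpha>\<in>multi_indices 2. ennreal (cmod (multi_deriv \<alpha> f z)))"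
      unfolding mult.assoc by (rule ennreal_mult_SUP_le[OF pos(2) _ *]) simp_all
  qed
qed

end
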